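(* Let $(\mathcal{E},\mathcal{H},D)$ be an operator system spectral triple and, for each $n\in\mathbb{N}$, let $(\mathcal{E}_n,\mathcal{H}_n,D_n)$ be an operator system spectral triple, all of them having the BW property. Let $E$ (respectively $E_n$) be the closed operator system in which $\mathcal{E}$ (respectively $\mathcal{E}_n$) is dense. If there are maps $(R_n,S_n)$, $n\in\mathbb{N}$, forming a $C^1$-approximate complete order isomorphism for $(\mathcal{E}_n,\mathcal{H}_n,D_n)$ and $(\mathcal{E},\mathcal{H},D)$, then the metric spaces $(\mathcal{UCP}_{\mathcal{K}}(E_n),d_{E_n})$ converge to $(\mathcal{UCP}_{\mathcal{K}}(E),d_E)$ in the Gromov-Hausdorff metric as $n\to\infty$.
   Context: $\mathcal{K}$ is a complex separable Hilbert space and $\{k_p:p\in\mathbb{N}\}$ is a fixed dense subset of its closed unit ball (the same for all metrics below). For a closed operator system $E$, $\mathcal{UCP}_{\mathcal{K}}(E)$ is the set of all unital completely positive (ucp) maps $E\to\mathcal{B}(\mathcal{K})$. The BW-topology on it is the restriction of the weak* topology of $\mathcal{B}(E,\mathcal{B}(\mathcal{K}))$, regarded as the dual of the closed linear span of the functionals $L\mapsto L(x)(y)$ ($x\in E$, $y$ in the predual of $\mathcal{B}(\mathcal{K})$); a bounded net $L_\lambda$ converges to $L$ in it iff $\langle L_\lambda(x)h,h'\rangle\to\langle L(x)h,h'\rangle$ for all $x\in E$, $h,h'\in\mathcal{K}$. An operator system spectral triple is a triple $(\mathcal{E},\mathcal{H},D)$ where $\mathcal{H}$ is a Hilbert space,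 $\mathcal{E}$ is a dense subspace of a (closed) operator system $E\subseteq\mathcal{B}(\mathcal{H})$, and $D$ is a self-adjoint operator in $\mathcal{H}$ with compact resolvent such that $[D,T]$ is a bounded operator for all $T\in\mathcal{E}$. Put $\|T\|_1=\|[D,T]\|$ for $T\in\mathcal{E}$ (Lipschitz seminorm), and for $\phi,\psi\in\mathcal{UCP}_{\mathcal{K}}(E)$ $$d_E(\phi,\psi)=\sup\Big\{\sum_{p=1}^\infty\frac{1}{2^p}|\langle(\phi-\psi)(f)k_p,k_p\rangle| : f\in\mathcal{E},\ \|f\|\le1,\ \|f\|_1\le1\Big\}.$$ The triple has the BW property if the metric topology on $\mathcal{UCP}_{\mathcal{K}}(E)$ induced by $d_E$ coincides with the BW-topology. The function $d_{E_n}$ and the seminorm $\|\cdot\|_1=\|[D_n,\cdot]\|$ on $\mathcal{E}_n$ are defined in the same way from $(\mathcal{E}_n,\mathcal{H}_n,D_n)$. A $C^1$-approximate complete order isomorphism for $(\mathcal{E}_n,\mathcal{H}_n,D_n)$ and $(\mathcal{E},\mathcal{H},D)$ consists, for each $n$, of a pair of linear maps $R_n:\mathcal{E}\to\mathcal{E}_n$ and $S_n:\mathcal{E}_n\to\mathcal{E}$ such that: (1) $R_n$ and $S_n$ are unital completely positive; (2) $R_n$ and $S_n$ are contractive both with respect to the norms $\|\cdot\|$ and with respect to the Lipschitz seminorms $\|\cdot\|_1$; (3) there are sequences $c_n\to0$ and $c_n'\to0$ with $\|S_n R_n(f)-f\|\le c_n\|f\|_1$ for all $f\in\mathcal{E}$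 and $\|R_nS_n(h)-h\|\le c_n'\|h\|_1$ for all $h\in\mathcal{E}_n$. Being norm contractive, $R_n$ and $S_n$ extend by continuity to $E\to E_n$ and $E_n\to E$, and (1) is understood to include that these extensions are ucp. The Gromov-Hausdorff distance between compact metric spaces $M_1,M_2$ is the infimum of the Hausdorff distances $d_H(f(M_1),g(M_2))$ over all compact metric spaces $M$ and isometric embeddings $f:M_1\to M$, $g:M_2\to M$. *)

theory Defs
  imports "HOL-Analysis.Analysis"
begin

section \<open>Complex Hilbert spaces\<close>

class scaleC = scaleR +
  fixes scaleC :: "complex \<Rightarrow> 'a \<Rightarrow> 'a" (infixr \<open>*\<^sub>C\<close> 75)

class complex_vector = real_vector + scaleC +
  assumes scaleC_add_right: "a *\<^sub>C (x + y) = a *\<^sub>C x + a *\<^sub>C y"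
    and scaleC_add_left: "(a + b) *\<^sub>C x = a *\<^sub>C x + b *\<^sub>C x"
    and scaleC_scaleC: "a *\<^sub>C (b *\<^sub>C x) = (a * b) *\<^sub>C x"
    and scaleR_scaleC: "r *\<^sub>R x = complex_of_real r *\<^sub>C x"

class complex_normed_vector = complex_vector + real_normed_vector +
  assumes norm_scaleC: "norm (a *\<^sub>C x) = cmod a * norm x"

text \<open>The inner product is linear in the first argument; its real part is the
  inner product of \<open>real_inner\<close>, which fixes norm and topology.\<close>

class complex_inner = complex_vector + real_inner +
  fixes cinner :: "'a \<Rightarrow> 'a \<Rightarrow> complex"
  assumes cinner_commute: "cinner x y = cnj (cinner y x)"
    and cinner_add_left: "cinner (x + y) z = cinner x z + cinner y z"
    and cinner_scaleC_left: "cinner (a *\<^sub>C x) y = a * cinner x y"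
    and inner_eq_Re_cinner: "inner x y = Re (cinner x y)"

class chilbert_space = complex_inner + complete_space

lemma cinner_self: "cinner x x = complex_of_real ((norm x)\<^sup>2)"
  for x :: "'a::complex_inner"
proof -
  have "Im (cinner x x) = 0"
    using arg_cong[OF cinner_commute[of x x], of Im] by simp
  moreover have "Re (cinner x x) = (norm x)\<^sup>2"
    by (simp add: power2_norm_eq_inner inner_eq_Re_cinner)
  ultimately show ?thesis
    by (simp add: complex_eq_iff)
qed

subclass (in complex_inner) complex_normed_vector
proof
  fix a :: complex and x :: 'a
  have re: "Re (cinner u u) = (norm u)\<^sup>2" for u :: 'a
    by (metis inner_eq_Re_cinner norm_eq_sqrt_inner inner_ge_zero real_sqrt_pow2)
  have im: "Im (cinner x x) = 0"
    using arg_cong[OF cinner_commute[of x x], of Im] by simp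
  have "cinner (a *\<^sub>C x) (a *\<^sub>C x) = a * cnj (a * cinner x x)"
    by (metis cinner_commute cinner_scaleC_left)
  also have "\<dots> = (a * cnj a) * cnj (cinner x x)"
    by simp
  finally have "Re (cinner (a *\<^sub>C x) (a *\<^sub>C x)) = (cmod a)\<^sup>2 * Re (cinner x x)"
    using im by (simp add: complex_mult_cnj cmod_power2)
  then have "(norm (a *\<^sub>C x))\<^sup>2 = (cmod a * norm x)\<^sup>2"
    by (simp add: re power_mult_distrib)
  moreover have "norm u \<ge> 0" for u :: 'a
    by (metis inner_ge_zero norm_eq_sqrt_inner real_sqrt_ge_zero)
  ultimately show "norm (a *\<^sub>C x) = cmod a * norm x"
    by (rule power2_eq_imp_eq) simp_all
qed

lemma bounded_linear_scaleC_comp: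
  fixes f :: "'a::real_normed_vector \<Rightarrow> 'b::complex_normed_vector"
  assumes "bounded_linear f"
  shows "bounded_linear (\<lambda>x. c *\<^sub>C f x)"
proof -
  interpret f: bounded_linear f by fact
  obtain K where K: "\<And>x. norm (f x) \<le> norm x * K"
    using f.bounded by blast
  show ?thesis
  proof (rule bounded_linear_intro[where K = "cmod c * K"])
    show "c *\<^sub>C f (x + y) = c *\<^sub>C f x + c *\<^sub>C f y" for x y
      by (simp add: f.add scaleC_add_right)
    show "c *\<^sub>C f (r *\<^sub>R x) = r *\<^sub>R c *\<^sub>C f x" for r x
      by (simp add: f.scaleR scaleR_scaleC scaleC_scaleC mult.commute)
    show "norm (c *\<^sub>C f x) \<le> norm x * (cmod c * K)" for x
      using mult_left_mono[OF K[of x], of "cmod c"] by (simp add: norm_scaleC mult_ac)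
  qed
qed

instantiation blinfun :: (real_normed_vector, complex_normed_vector) complex_normed_vector
begin

lift_definition scaleC_blinfun :: "complex \<Rightarrow> 'a \<Rightarrow>\<^sub>L 'b \<Rightarrow> 'a \<Rightarrow>\<^sub>L 'b" is "\<lambda>c f x. c *\<^sub>C f x"
  by (rule bounded_linear_scaleC_comp)

instance
proof
  fix a b :: complex and x y :: "'a \<Rightarrow>\<^sub>L 'b"
  show "a *\<^sub>C (x + y) = a *\<^sub>C x + a *\<^sub>C y"
    by transfer (simp add: scaleC_add_right)
  show "(a + b) *\<^sub>C x = a *\<^sub>C x + b *\<^sub>C x"
    by transfer (simp add: scaleC_add_left)
  show assoc: "a *\<^sub>C (b *\<^sub>C x) = (a * b) *\<^sub>C x" for a b and x :: "'a \<Rightarrow>\<^sub>L 'b"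
    by transfer (simp add: scaleC_scaleC)
  show *: "r *\<^sub>R x = complex_of_real r *\<^sub>C x" for r and x :: "'a \<Rightarrow>\<^sub>L 'b"
    by transfer (simp add: scaleR_scaleC)
  have le: "norm (c *\<^sub>C z) \<le> cmod c * norm z" for c and z :: "'a \<Rightarrow>\<^sub>L 'b"
  proof (rule norm_blinfun_bound)
    show "norm (blinfun_apply (c *\<^sub>C z) v) \<le> cmod c * norm z * norm v" for v
      using mult_left_mono[OF norm_blinfun[of z v], of "cmod c"]
      by (simp add: scaleC_blinfun.rep_eq norm_scaleC mult_ac)
  qed simp
  show "norm (a *\<^sub>C x) = cmod a * norm x"
  proof (cases "a = 0")
    case True
    then show ?thesis using le[of 0 x] by simp
  next
    case False
    have "inverse a *\<^sub>C a *\<^sub>C x = 1 *\<^sub>C x"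
      using False by (simp add: assoc)
    also have "1 *\<^sub>C x = x"
      using *[of 1 x] by (simp only: of_real_1 scaleR_one)
    finally have "norm x \<le> inverse (cmod a) * norm (a *\<^sub>C x)"
      using le[of "inverse a" "a *\<^sub>C x"] by (simp only: norm_inverse)
    then have "cmod a * norm x \<le> norm (a *\<^sub>C x)"
      using False by (simp add: field_simps)
    then show ?thesis using le[of a x] by linarith
  qed
qed

end

definition csubspace :: "'a::complex_vector set \<Rightarrow> bool" where
  "csubspace V \<longleftrightarrow> subspace V \<and> (\<forall>c. \<forall>x\<in>V. c *\<^sub>C x \<in> V)"

definition clinear_on ::
  "'a::complex_vector set \<Rightarrow> 'b::complex_vector set \<Rightarrow> ('a \<Rightarrow> 'b) \<Rightarrow> bool" where
  "clinear_on V W f \<longleftrightarrow> f ` V \<subseteq> W \<and>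
     (\<forall>x\<in>V. \<forall>y\<in>V. f (x + y) = f x + f y) \<and> (\<forall>c. \<forall>x\<in>V. f (c *\<^sub>C x) = c *\<^sub>C f x)"


section \<open>Operators on a Hilbert space\<close>

text \<open>A Hilbert space is a closed complex subspace \<open>H\<close> of a type of class \<open>chilbert_space\<close>;
  this way a sequence of different (arbitrary) Hilbert spaces lives in one type, e.g. in their
  Hilbert sum.  An operator on \<open>H\<close> is represented by its extension by \<open>0\<close> on the orthogonal
  complement of \<open>H\<close>.  This makes \<open>bop H\<close> a copy of \<open>B(H)\<close> with the same norm and adjoints,
  whose unit \<open>idop H\<close> is the orthogonal projection onto \<open>H\<close>.
  For \<open>H = UNIV\<close> it consists of all bounded complex-linear operators.\<close>

definition hilbert_subspace :: "'h::chilbert_space set \<Rightarrow> bool" where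
  "hilbert_subspace H \<longleftrightarrow> csubspace H \<and> closed H"

definition bop :: "'h::chilbert_space set \<Rightarrow> ('h \<Rightarrow>\<^sub>L 'h) set" where
  "bop H = {T. (\<forall>c x. blinfun_apply T (c *\<^sub>C x) = c *\<^sub>C blinfun_apply T x) \<and>
               (\<forall>x. blinfun_apply T x \<in> H) \<and>
               (\<forall>x. (\<forall>y\<in>H. cinner x y = 0) \<longrightarrow> blinfun_apply T x = 0)}"

definition idop :: "'h::chilbert_space set \<Rightarrow> 'h \<Rightarrow>\<^sub>L 'h" where
  "idop H = (THE P. P \<in> bop H \<and> (\<forall>x\<in>H. blinfun_apply P x = x))"

definition operator_system :: "'h::chilbert_space set \<Rightarrow> ('h \<Rightarrow>\<^sub>L 'h) set \<Rightarrow> bool" where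
  "operator_system H E \<longleftrightarrow> E \<subseteq> bop H \<and> csubspace E \<and> closed E \<and> idop H \<in> E \<and>
     (\<forall>T\<in>E. \<exists>S\<in>E. \<forall>x y. cinner (blinfun_apply T x) y = cinner x (blinfun_apply S y))"

text \<open>Positivity of the \<open>m \<times> m\<close> matrix \<open>T\<close> as an operator on the \<open>m\<close>-fold sum of \<open>H\<close>.\<close>

definition mat_pos ::
  "'h::chilbert_space set \<Rightarrow> nat \<Rightarrow> (nat \<Rightarrow> nat \<Rightarrow> 'h \<Rightarrow>\<^sub>L 'h) \<Rightarrow> bool" where
  "mat_pos H m T \<longleftrightarrow> (\<forall>v. (\<forall>i<m. v i \<in> H) \<longrightarrow>
     (\<Sum>i<m. \<Sum>j<m. cinner (blinfun_apply (T i j) (v j)) (v i)) \<in> \<real>\<^sub>\<ge>\<^sub>0)"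

definition completely_positive ::
  "'h::chilbert_space set \<Rightarrow> ('h \<Rightarrow>\<^sub>L 'h) set \<Rightarrow> 'g::chilbert_space set \<Rightarrow>
   (('h \<Rightarrow>\<^sub>L 'h) \<Rightarrow> ('g \<Rightarrow>\<^sub>L 'g)) \<Rightarrow> bool" where
  "completely_positive H X G \<phi> \<longleftrightarrow> (\<forall>m T. (\<forall>i<m. \<forall>j<m. T i j \<in> X) \<longrightarrow>
     mat_pos H m T \<longrightarrow> mat_pos G m (\<lambda>i j. \<phi> (T i j)))"

definition ucp_map ::
  "'h::chilbert_space set \<Rightarrow> ('h \<Rightarrow>\<^sub>L 'h) set \<Rightarrow> 'g::chilbert_space set \<Rightarrow> ('g \<Rightarrow>\<^sub>L 'g) set \<Rightarrow>
   (('h \<Rightarrow>\<^sub>L 'h) \<Rightarrow> ('g \<Rightarrow>\<^sub>L 'g)) \<Rightarrow> bool" where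
  "ucp_map H X G Y \<phi> \<longleftrightarrow>
     clinear_on X Y \<phi> \<and> \<phi> (idop H) = idop G \<and> completely_positive H X G \<phi>"

text \<open>The Hilbert space \<open>K\<close> is the type \<open>'k\<close>.  Maps on \<open>E\<close> are total functions that are
  \<open>undefined\<close> outside of \<open>E\<close>.\<close>

definition UCP ::
  "'h::chilbert_space set \<Rightarrow> ('h \<Rightarrow>\<^sub>L 'h) set \<Rightarrow> (('h \<Rightarrow>\<^sub>L 'h) \<Rightarrow> ('k::chilbert_space \<Rightarrow>\<^sub>L 'k)) set" where
  "UCP H E = {\<phi> \<in> extensional E. ucp_map H E UNIV (bop UNIV) \<phi>}"


section \<open>The BW-topology\<close>

definition bounded_maps ::
  "('h::chilbert_space \<Rightarrow>\<^sub>L 'h) set \<Rightarrow> (('h \<Rightarrow>\<^sub>L 'h) \<Rightarrow> ('k::chilbert_space \<Rightarrow>\<^sub>L 'k)) set" where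
  "bounded_maps E = {L \<in> extensional E. clinear_on E (bop UNIV) L \<and>
     (\<exists>C. \<forall>x\<in>E. norm (L x) \<le> C * norm x)}"

text \<open>The predual of \<open>B(K)\<close>: the functionals \<open>T \<mapsto> tr (\<rho> T)\<close> with \<open>\<rho>\<close> of trace class.\<close>

definition bop_predual :: "(('k::chilbert_space \<Rightarrow>\<^sub>L 'k) \<Rightarrow> complex) set" where
  "bop_predual = {\<lambda>T. \<Sum>j. cinner (blinfun_apply T (a j)) (b j) | a b :: nat \<Rightarrow> 'k.
     summable (\<lambda>j. (norm (a j))\<^sup>2) \<and> summable (\<lambda>j. (norm (b j))\<^sup>2)}"

definition elementary_functionals ::
  "('h::chilbert_space \<Rightarrow>\<^sub>L 'h) set \<Rightarrow>
   ((('h \<Rightarrow>\<^sub>L 'h) \<Rightarrow> ('k::chilbert_space \<Rightarrow>\<^sub>L 'k)) \<Rightarrow> complex) set" where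
  "elementary_functionals E = {\<lambda>L. y (L x) | x y. x \<in> E \<and> y \<in> bop_predual}"

text \<open>The closed linear span of the elementary functionals in the dual of \<open>bounded_maps E\<close>:
  norm distance at most \<open>\<epsilon>\<close> is spelled out by the last line.\<close>

definition weak_star_predual ::
  "('h::chilbert_space \<Rightarrow>\<^sub>L 'h) set \<Rightarrow>
   ((('h \<Rightarrow>\<^sub>L 'h) \<Rightarrow> ('k::chilbert_space \<Rightarrow>\<^sub>L 'k)) \<Rightarrow> complex) set" where
  "weak_star_predual E = {z. \<forall>\<epsilon>>0. \<exists>F c. finite F \<and> F \<subseteq> elementary_functionals E \<and>
     (\<forall>L\<in>bounded_maps E. \<forall>C\<ge>0. (\<forall>x\<in>E. norm (L x) \<le> C * norm x) \<longrightarrow>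
        cmod (z L - (\<Sum>f\<in>F. c f * f L)) \<le> \<epsilon> * C)}"

definition weak_star_topology ::
  "('h::chilbert_space \<Rightarrow>\<^sub>L 'h) set \<Rightarrow> (('h \<Rightarrow>\<^sub>L 'h) \<Rightarrow> ('k::chilbert_space \<Rightarrow>\<^sub>L 'k)) topology" where
  "weak_star_topology E = topology_generated_by
     {{L \<in> bounded_maps E. z L \<in> U} | z U. z \<in> weak_star_predual E \<and> open U}"

definition BW_topology ::
  "'h::chilbert_space set \<Rightarrow> ('h \<Rightarrow>\<^sub>L 'h) set \<Rightarrow>
   (('h \<Rightarrow>\<^sub>L 'h) \<Rightarrow> ('k::chilbert_space \<Rightarrow>\<^sub>L 'k)) topology" where
  "BW_topology H E = subtopology (weak_star_topology E) (UCP H E)"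


section \<open>Operator system spectral triples\<close>

text \<open>The Hilbert space, the dense subspace of the operator system, and the unbounded
  operator given by its domain and its action there.\<close>

record (overloaded) 'h striple =
  hspace :: "'h set"
  smooth :: "('h \<Rightarrow>\<^sub>L 'h) set"
  ddom :: "'h set"
  dirac :: "'h \<Rightarrow> 'h"

definition opsys :: "'h::chilbert_space striple \<Rightarrow> ('h \<Rightarrow>\<^sub>L 'h) set" where
  "opsys A = closure (smooth A)"

text \<open>\<open>D\<close> is densely defined, linear, and its graph is the graph of its adjoint.\<close>

definition self_adjoint_in :: "'h::chilbert_space set \<Rightarrow> 'h set \<Rightarrow> ('h \<Rightarrow> 'h) \<Rightarrow> bool" where
  "self_adjoint_in H W D \<longleftrightarrow> csubspace W \<and> W \<subseteq> H \<and> H \<subseteq> closure W \<and> clinear_on W H D \<and>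
     {(x, D x) | x. x \<in> W} =
     {(y, z). y \<in> H \<and> z \<in> H \<and> (\<forall>x\<in>W. cinner (D x) y = cinner x z)}"

text \<open>Some resolvent \<open>(D - c)\<^sup>-\<^sup>1\<close> exists on all of \<open>H\<close> and is a compact operator.\<close>

definition compact_resolvent :: "'h::chilbert_space set \<Rightarrow> 'h set \<Rightarrow> ('h \<Rightarrow> 'h) \<Rightarrow> bool" where
  "compact_resolvent H W D \<longleftrightarrow> (\<exists>c. bij_betw (\<lambda>x. D x - c *\<^sub>C x) W H \<and>
     compact (closure (inv_into W (\<lambda>x. D x - c *\<^sub>C x) ` (H \<inter> cball 0 1))))"

definition bounded_commutator :: "'h::chilbert_space set \<Rightarrow> ('h \<Rightarrow> 'h) \<Rightarrow> ('h \<Rightarrow>\<^sub>L 'h) \<Rightarrow> bool" where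
  "bounded_commutator W D T \<longleftrightarrow> blinfun_apply T ` W \<subseteq> W \<and>
     (\<exists>C. \<forall>x\<in>W. norm (D (blinfun_apply T x) - blinfun_apply T (D x)) \<le> C * norm x)"

definition spectral_triple :: "'h::chilbert_space striple \<Rightarrow> bool" where
  "spectral_triple A \<longleftrightarrow> hilbert_subspace (hspace A) \<and>
     csubspace (smooth A) \<and> operator_system (hspace A) (opsys A) \<and>
     self_adjoint_in (hspace A) (ddom A) (dirac A) \<and>
     compact_resolvent (hspace A) (ddom A) (dirac A) \<and>
     (\<forall>T\<in>smooth A. bounded_commutator (ddom A) (dirac A) T)"

text \<open>The operator norm of \<open>[D, T]\<close>; only used for \<open>T\<close> with bounded commutator.\<close>

definition lipnorm :: "'h::chilbert_space striple \<Rightarrow> ('h \<Rightarrow>\<^sub>L 'h) \<Rightarrow> real" where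
  "lipnorm A T = (SUP x\<in>{x \<in> ddom A. norm x \<le> 1}.
     norm (dirac A (blinfun_apply T x) - blinfun_apply T (dirac A x)))"

text \<open>The supremum is not assumed to be finite.  The sequence \<open>k\<close> is indexed from \<open>0\<close>.\<close>

definition ucp_dist :: "(nat \<Rightarrow> 'k::chilbert_space) \<Rightarrow> 'h::chilbert_space striple \<Rightarrow>
    (('h \<Rightarrow>\<^sub>L 'h) \<Rightarrow> ('k \<Rightarrow>\<^sub>L 'k)) \<Rightarrow> (('h \<Rightarrow>\<^sub>L 'h) \<Rightarrow> ('k \<Rightarrow>\<^sub>L 'k)) \<Rightarrow> ennreal" where
  "ucp_dist k A \<phi> \<psi> = (SUP f\<in>{f \<in> smooth A. norm f \<le> 1 \<and> lipnorm A f \<le> 1}.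
     \<Sum>p. ennreal (1 / 2 ^ Suc p * cmod (cinner (blinfun_apply (\<phi> f - \<psi> f) (k p)) (k p))))"

definition UCP_of :: "'h::chilbert_space striple \<Rightarrow> (('h \<Rightarrow>\<^sub>L 'h) \<Rightarrow> ('k::chilbert_space \<Rightarrow>\<^sub>L 'k)) set" where
  "UCP_of A = UCP (hspace A) (opsys A)"

definition emetric_topology :: "'a set \<Rightarrow> ('a \<Rightarrow> 'a \<Rightarrow> ennreal) \<Rightarrow> 'a topology" where
  "emetric_topology M d =
     topology (\<lambda>U. U \<subseteq> M \<and> (\<forall>x\<in>U. \<exists>r>0. {y \<in> M. d x y < ennreal r} \<subseteq> U))"

lemma openin_emetric_topology:
  "openin (emetric_topology M d) U \<longleftrightarrow>
     U \<subseteq> M \<and> (\<forall>x\<in>U. \<exists>r>0. {y \<in> M. d x y < ennreal r} \<subseteq> U)"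
proof -
  have "istopology (\<lambda>U. U \<subseteq> M \<and> (\<forall>x\<in>U. \<exists>r>0. {y \<in> M. d x y < ennreal r} \<subseteq> U))"
    unfolding istopology_def
  proof (intro conjI allI impI)
    fix S T
    assume S: "S \<subseteq> M \<and> (\<forall>x\<in>S. \<exists>r>0. {y \<in> M. d x y < ennreal r} \<subseteq> S)"
      and T: "T \<subseteq> M \<and> (\<forall>x\<in>T. \<exists>r>0. {y \<in> M. d x y < ennreal r} \<subseteq> T)"
    show "S \<inter> T \<subseteq> M" using S by blast
    show "\<forall>x\<in>S \<inter> T. \<exists>r>0. {y \<in> M. d x y < ennreal r} \<subseteq> S \<inter> T"
    proof
      fix x assume "x \<in> S \<inter> T"
      then obtain r s where "r > 0" "{y \<in> M. d x y < ennreal r} \<subseteq> S"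
        "s > 0" "{y \<in> M. d x y < ennreal s} \<subseteq> T"
        using S T by blast
      moreover have "u < ennreal r" "u < ennreal s" if "u < ennreal (min r s)" for u
        using that by (auto elim!: less_le_trans intro!: ennreal_leI)
      ultimately show "\<exists>r>0. {y \<in> M. d x y < ennreal r} \<subseteq> S \<inter> T"
        by (intro exI[of _ "min r s"]) auto
    qed
  next
    fix \<K>
    assume *: "\<forall>S\<in>\<K>. S \<subseteq> M \<and> (\<forall>x\<in>S. \<exists>r>0. {y \<in> M. d x y < ennreal r} \<subseteq> S)"
    then show "\<Union>\<K> \<subseteq> M" by blast
    show "\<forall>x\<in>\<Union>\<K>. \<exists>r>0. {y \<in> M. d x y < ennreal r} \<subseteq> \<Union>\<K>"
      using * by (meson Sup_upper UnionE subset_trans)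
  qed
  then show ?thesis
    by (simp add: emetric_topology_def topology_inverse')
qed

definition BW_property :: "(nat \<Rightarrow> 'k::chilbert_space) \<Rightarrow> 'h::chilbert_space striple \<Rightarrow> bool" where
  "BW_property k A \<longleftrightarrow>
     emetric_topology (UCP_of A) (ucp_dist k A) = BW_topology (hspace A) (opsys A)"


section \<open>Approximate complete order isomorphisms\<close>

text \<open>The given map on the dense subspace \<open>smooth A\<close> has a ucp continuous extension.  Its
  restriction is then a ucp map itself, as the positive matrices over \<open>smooth A\<close>
  are also positive matrices over \<open>opsys A\<close>.\<close>

definition ucp_extendable ::
  "'h::chilbert_space striple \<Rightarrow> 'g::chilbert_space striple \<Rightarrow>
   (('h \<Rightarrow>\<^sub>L 'h) \<Rightarrow> ('g \<Rightarrow>\<^sub>L 'g)) \<Rightarrow> bool" where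
  "ucp_extendable A B R \<longleftrightarrow> (\<exists>Q. continuous_on (opsys A) Q \<and> (\<forall>f\<in>smooth A. Q f = R f) \<and>
     ucp_map (hspace A) (opsys A) (hspace B) (opsys B) Q)"

definition contractive ::
  "'h::chilbert_space striple \<Rightarrow> 'g::chilbert_space striple \<Rightarrow>
   (('h \<Rightarrow>\<^sub>L 'h) \<Rightarrow> ('g \<Rightarrow>\<^sub>L 'g)) \<Rightarrow> bool" where
  "contractive A B R \<longleftrightarrow>
     (\<forall>f\<in>smooth A. norm (R f) \<le> norm f \<and> lipnorm B (R f) \<le> lipnorm A f)"

definition C1_approx_coi ::
  "(nat \<Rightarrow> 'g::chilbert_space striple) \<Rightarrow> 'h::chilbert_space striple \<Rightarrow>
   (nat \<Rightarrow> ('h \<Rightarrow>\<^sub>L 'h) \<Rightarrow> ('g \<Rightarrow>\<^sub>L 'g)) \<Rightarrow> (nat \<Rightarrow> ('g \<Rightarrow>\<^sub>L 'g) \<Rightarrow> ('h \<Rightarrow>\<^sub>L 'h)) \<Rightarrow> bool" where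
  "C1_approx_coi An A R S \<longleftrightarrow>
     (\<forall>n. clinear_on (smooth A) (smooth (An n)) (R n) \<and>
          clinear_on (smooth (An n)) (smooth A) (S n)) \<and>
     (\<forall>n. ucp_extendable A (An n) (R n) \<and> ucp_extendable (An n) A (S n)) \<and>
     (\<forall>n. contractive A (An n) (R n) \<and> contractive (An n) A (S n)) \<and>
     (\<exists>c c'. c \<longlonglongrightarrow> 0 \<and> c' \<longlonglongrightarrow> 0 \<and>
        (\<forall>n. \<forall>f\<in>smooth A. norm (S n (R n f) - f) \<le> c n * lipnorm A f) \<and>
        (\<forall>n. \<forall>h\<in>smooth (An n). norm (R n (S n h) - h) \<le> c' n * lipnorm (An n) h))"


section \<open>Gromov-Hausdorff distance\<close>

definition compact_metric :: "'a set \<Rightarrow> ('a \<Rightarrow> 'a \<Rightarrow> ennreal) \<Rightarrow> bool" where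
  "compact_metric M d \<longleftrightarrow> (\<exists>d'. Metric_space M d' \<and>
     compact_space (Metric_space.mtopology M d') \<and> (\<forall>x\<in>M. \<forall>y\<in>M. d x y = ennreal (d' x y)))"

definition hausdorff_dist :: "('a \<Rightarrow> 'a \<Rightarrow> real) \<Rightarrow> 'a set \<Rightarrow> 'a set \<Rightarrow> ennreal" where
  "hausdorff_dist d A B =
     max (SUP a\<in>A. INF b\<in>B. ennreal (d a b)) (SUP b\<in>B. INF a\<in>A. ennreal (d a b))"

definition isometric_embedding ::
  "'a set \<Rightarrow> ('a \<Rightarrow> 'a \<Rightarrow> ennreal) \<Rightarrow> 'b set \<Rightarrow> ('b \<Rightarrow> 'b \<Rightarrow> real) \<Rightarrow> ('a \<Rightarrow> 'b) \<Rightarrow> bool" where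
  "isometric_embedding M1 d1 M d f \<longleftrightarrow>
     f ` M1 \<subseteq> M \<and> (\<forall>x\<in>M1. \<forall>y\<in>M1. ennreal (d (f x) (f y)) = d1 x y)"

text \<open>The ambient compact metric spaces range over subsets of the sum type.  By the lemma
  below this loses nothing: an arbitrary ambient space can be replaced by the union of the two
  images, which is in bijection with a subset of the sum.\<close>

definition gromov_hausdorff_dist ::
  "'a set \<Rightarrow> ('a \<Rightarrow> 'a \<Rightarrow> ennreal) \<Rightarrow> 'b set \<Rightarrow> ('b \<Rightarrow> 'b \<Rightarrow> ennreal) \<Rightarrow> ennreal" where
  "gromov_hausdorff_dist M1 d1 M2 d2 =
     Inf {hausdorff_dist d (f ` M1) (g ` M2) | (M :: ('a + 'b) set) d f g.
            Metric_space M d \<and> compact_space (Metric_space.mtopology M d) \<and>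
            isometric_embedding M1 d1 M d f \<and> isometric_embedding M2 d2 M d g}"

lemma compactin_isometric_image:
  assumes "compact_metric M1 d1" "Metric_space M d" "isometric_embedding M1 d1 M d f"
  shows "compactin (Metric_space.mtopology M d) (f ` M1)"
proof -
  obtain d' where d': "Metric_space M1 d'" "compact_space (Metric_space.mtopology M1 d')"
    "\<And>x y. x \<in> M1 \<Longrightarrow> y \<in> M1 \<Longrightarrow> d1 x y = ennreal (d' x y)"
    using assms(1) unfolding compact_metric_def by blast
  interpret M1: Metric_space M1 d' by fact
  interpret M: Metric_space M d by fact
  have fM: "f ` M1 \<subseteq> M"
    using assms(3) by (simp add: isometric_embedding_def)
  have eq: "d (f x) (f y) = d' x y" if "x \<in> M1" "y \<in> M1" for x y
  proof -
    have "ennreal (d (f x) (f y)) = ennreal (d' x y)"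
      using assms(3) d'(3) that by (simp add: isometric_embedding_def)
    then show ?thesis by simp
  qed
  have "continuous_map M1.mtopology M.mtopology f"
    unfolding M1.metric_continuous_map[OF M.Metric_space_axioms] using fM by (auto simp: eq)
  then show ?thesis
    using d'(2) image_compactin[of M1.mtopology M1 M.mtopology f] by (simp add: compact_space_def)
qed

lemma gromov_hausdorff_dist_le:
  fixes M1 :: "'a set" and M2 :: "'b set" and M :: "'c set"
  assumes c1: "compact_metric M1 d1" and c2: "compact_metric M2 d2" and M: "Metric_space M d"
    and f: "isometric_embedding M1 d1 M d f" and g: "isometric_embedding M2 d2 M d g"
  shows "gromov_hausdorff_dist M1 d1 M2 d2 \<le> hausdorff_dist d (f ` M1) (g ` M2)"
proof -
  interpret M: Metric_space M d by fact
  define N where "N = Inl ` M1 \<union> Inr ` {y \<in> M2. g y \<notin> f ` M1}"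
  define q where "q = case_sum f g"
  define dN where "dN = (\<lambda>u v. d (q u) (q v))"
  define G where "G = (\<lambda>y. if g y \<in> f ` M1 then Inl (inv_into M1 f (g y)) else (Inr y :: 'a + 'b))"
  have inj: "inj_on h X" if emb: "isometric_embedding X e M d h" and cpt: "compact_metric X e"
    for h :: "'x \<Rightarrow> 'c" and X e
  proof (rule inj_onI)
    fix x y assume xy: "x \<in> X" "y \<in> X" "h x = h y"
    obtain e' where e': "Metric_space X e'" "e x y = ennreal (e' x y)"
      using cpt xy unfolding compact_metric_def by blast
    interpret X: Metric_space X e' by fact
    have "e x y = ennreal (d (h x) (h y))" "h x \<in> M"
      using emb xy(1,2) unfolding isometric_embedding_def by (metis, blast)
    then have "ennreal (e' x y) = 0" using xy e' by simp
    then show "x = y" using xy by (simp add: ennreal_eq_0_iff order_antisym_conv)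
  qed
  have fM: "f ` M1 \<subseteq> M" and gM: "g ` M2 \<subseteq> M"
    using f g by (simp_all add: isometric_embedding_def)
  have injf: "inj_on f M1" by (rule inj[OF f c1])
  have injg: "inj_on g M2" by (rule inj[OF g c2])
  have qN: "q ` N = f ` M1 \<union> g ` M2"
    unfolding N_def q_def by (auto simp: image_Un image_image)
  have injq: "inj_on q N"
  proof (rule inj_onI)
    fix u v assume "u \<in> N" "v \<in> N" "q u = q v"
    moreover have "x = y" if "x \<in> M1" "y \<in> M1" "f x = f y" for x y
      using injf that by (blast dest: inj_onD)
    moreover have "x = y" if "x \<in> M2" "y \<in> M2" "g x = g y" for x y
      using injg that by (blast dest: inj_onD)
    moreover have "g y \<in> f ` M1" if "x \<in> M1" "f x = g y" for x y
      using that by (metis imageI)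
    ultimately show "u = v"
      by (cases u; cases v) (auto simp: N_def q_def)
  qed
  have qG: "q (G y) = g y" if "y \<in> M2" for y
    unfolding q_def G_def by (simp add: f_inv_into_f)
  have GN: "G y \<in> N" if "y \<in> M2" for y
    using that unfolding G_def N_def by (auto intro: inv_into_into)
  have qInl: "q (Inl x) = f x" for x by (simp add: q_def)
  have NM: "q u \<in> M" if "u \<in> N" for u using that qN fM gM by blast
  have MN: "Metric_space N dN"
  proof
    show "0 \<le> dN x y" for x y by (simp add: dN_def)
    show "dN x y = dN y x" for x y by (simp add: dN_def M.commute)
    show "dN x y = 0 \<longleftrightarrow> x = y" if "x \<in> N" "y \<in> N" for x y
      using that NM injq by (auto simp: dN_def inj_on_def)
    show "dN x z \<le> dN x y + dN y z" if "x \<in> N" "y \<in> N" "z \<in> N" for x y z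
      using that NM M.triangle by (simp add: dN_def)
  qed
  interpret N: Metric_space N dN by fact
  define Z where "Z = f ` M1 \<union> g ` M2"
  interpret S: Submetric M d Z
    by unfold_locales (use fM gM in \<open>simp add: Z_def\<close>)
  have "compactin M.mtopology Z"
    unfolding Z_def using compactin_isometric_image[OF c1 M f] compactin_isometric_image[OF c2 M g]
    by (rule compactin_Un)
  then have "compact_space S.sub.mtopology"
    by (simp add: S.mtopology_submetric compact_space_subtopology)
  moreover have "continuous_map S.sub.mtopology N.mtopology (inv_into N q)"
    unfolding S.sub.metric_continuous_map[OF MN]
  proof (intro conjI ballI allI impI)
    show "inv_into N q ` Z \<subseteq> N" unfolding Z_def qN[symmetric] by (auto intro: inv_into_into)
    fix a and \<epsilon> :: real assume "a \<in> Z" "\<epsilon> > 0"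
    then show "\<exists>\<delta>>0. \<forall>x. x \<in> Z \<and> d a x < \<delta> \<longrightarrow> dN (inv_into N q a) (inv_into N q x) < \<epsilon>"
      by (intro exI[of _ \<epsilon>]) (auto simp: dN_def Z_def qN[symmetric] inv_into_f_f[OF injq])
  qed
  moreover have "inv_into N q ` Z = N"
    unfolding Z_def qN[symmetric] using injq by (rule inv_into_image_cancel) simp
  ultimately have "compactin N.mtopology N"
    using image_compactin[of S.sub.mtopology Z N.mtopology "inv_into N q"]
    by (simp add: compact_space_def)
  then have cN: "compact_space N.mtopology"
    by (simp add: compact_space_def)
  have e1: "isometric_embedding M1 d1 N dN Inl"
    using f by (auto simp: isometric_embedding_def dN_def qInl N_def)
  have e2: "isometric_embedding M2 d2 N dN G"
    using g GN by (auto simp: isometric_embedding_def dN_def qG)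
  have "hausdorff_dist dN (Inl ` M1) (G ` M2) = hausdorff_dist d (f ` M1) (g ` M2)"
  proof -
    have "f ` M1 = q ` Inl ` M1" "g ` M2 = q ` G ` M2"
      by (simp_all add: image_image qInl qG)
    then show ?thesis
      by (simp only: hausdorff_dist_def image_image dN_def)
  qed
  then show ?thesis
    unfolding gromov_hausdorff_dist_def using MN cN e1 e2
    by (intro Inf_lower) (metis (mono_tags, lifting) mem_Collect_eq)
qed

end

theory Submission
  imports Defs
begin

text \<open>
  Write \<open>X = UCP(E)\<close> and \<open>X\<^sub>n = UCP(E\<^sub>n)\<close>.  Precomposition with the continuous extensions of
  \<open>R\<^sub>n\<close> and \<open>S\<^sub>n\<close> gives maps \<open>X\<^sub>n \<rightarrow> X\<close> and \<open>X \<rightarrow> X\<^sub>n\<close>.  Both are 1-Lipschitz, because \<open>R\<^sub>n\<close> and \<open>S\<^sub>n\<close>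
  send the Lipschitz unit ball, over which the supremum in the metric is taken, into the Lipschitz
  unit ball (\<open>ucp_dist_pullback_le\<close>).  Their composites move points by at most \<open>\<bar>c\<^sub>n\<bar>\<close> and \<open>\<bar>c'\<^sub>n\<bar>\<close>, because
  ucp maps are contractive, so that \<open>\<parallel>\<phi>(S\<^sub>n R\<^sub>n f) - \<phi>(f)\<parallel> \<le> \<parallel>S\<^sub>n R\<^sub>n f - f\<parallel> \<le> \<bar>c\<^sub>n\<bar>\<close> for \<open>f\<close> in the
  Lipschitz ball (\<open>ucp_dist_round_trip_le\<close>).

  Two compact metric spaces with 1-Lipschitz maps \<open>F\<close>, \<open>G\<close> in both directions that are
  \<open>\<epsilon>\<close>-almost inverse to each other have Gromov-Hausdorff distance at most \<open>\<epsilon>\<close>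
  (\<open>gromov_hausdorff_dist_le_short_maps\<close>): the formula \<open>max (d\<^sub>1 x (G y)) (d\<^sub>2 (F x) y)\<close>,
  up to a small positive constant, extends the two metrics to the disjoint union, and the triangle
  inequalities follow from the 1-Lipschitz conditions.  With \<open>\<epsilon> = max \<bar>c\<^sub>n\<bar> \<bar>c'\<^sub>n\<bar>\<close> this gives the convergence.

  It remains to see that the spaces of ucp maps are compact metric spaces.  The supremum that
  defines the metric is at most 2, again by contractivity.  By the BW property its topology is the
  BW-topology, which is Hausdorff (so the metric separates points) and compact
  (\<open>compactin_weak_star_UCP\<close>).  Compactness is the Banach-Alaoglu argument: a ucp map
  \<open>\<phi>\<close> is encoded by its matrix coefficients \<open>\<langle>\<phi>(x) h, h'\<rangle>\<close>, the encodings form a closed subset of a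
  product of discs, and every functional of the predual is a uniform limit of continuous functions
  of the coefficients.  Recovering \<open>\<phi>\<close> from its coefficients uses the Riesz representation theorem;
  the same theorem yields the orthogonal projection that serves as the unit of \<open>B(H)\<close>.
\<close>

section \<open>Riesz representation and orthogonal projections\<close>

lemma cinner_add_right: "cinner x (y + z) = cinner x y + cinner x z"
  for x :: "'a::complex_inner"
  by (metis cinner_commute cinner_add_left complex_cnj_add)

lemma cinner_scaleC_right: "cinner x (a *\<^sub>C y) = cnj a * cinner x y"
  for x :: "'a::complex_inner"
  by (metis cinner_commute cinner_scaleC_left complex_cnj_mult)

lemma cinner_zero_left [simp]: "cinner 0 y = 0" for y :: "'a::complex_inner"
  using cinner_add_left[of 0 0 y] by simp

lemma cinner_zero_right [simp]: "cinner x 0 = 0" for x :: "'a::complex_inner"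
  using cinner_add_right[of x 0 0] by simp

lemma cinner_diff_left: "cinner (x - y) z = cinner x z - cinner y z"
  for x :: "'a::complex_inner"
  using cinner_add_left[of "x - y" y z] by simp

text \<open>
  Rotating \<open>x\<close> by a complex phase makes the product real and nonnegative, which reduces the claim
  to the Cauchy-Schwarz inequality of the real inner product.
\<close>

lemma norm_cinner_le: "cmod (cinner x y) \<le> norm x * norm y" for x :: "'a::complex_inner"
proof (cases "cinner x y = 0")
  case False
  define u where "u = cnj (cinner x y) / cmod (cinner x y)"
  have u: "cmod u = 1" "u * cinner x y = cmod (cinner x y)"
    using False complex_norm_square[of "cinner x y"]
    by (simp_all add: u_def norm_divide field_simps power2_eq_square)
  have "cmod (cinner x y) = Re (cinner (u *\<^sub>C x) y)"
    by (simp add: cinner_scaleC_left u)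
  also have "\<dots> \<le> norm (u *\<^sub>C x) * norm y"
    using norm_cauchy_schwarz[of "u *\<^sub>C x" y] by (simp add: inner_eq_Re_cinner)
  finally show ?thesis by (simp add: norm_scaleC u)
qed simp

lemma cinner_ext: "x = y" if "\<And>z. cinner x z = cinner y z" for x y :: "'a::complex_inner"
proof -
  have "cinner (x - y) (x - y) = 0"
    using that by (simp add: cinner_diff_left)
  then show ?thesis by (simp add: cinner_self)
qed

text \<open>
  The representing vector minimizes \<open>J(x) = \<parallel>x\<parallel>\<^sup>2 - 2 f(x)\<close> over \<open>H\<close>.  By the parallelogram law a
  minimizing sequence is Cauchy, and at a minimum the derivative of \<open>J\<close> in each direction of \<open>H\<close>
  vanishes.  Taking \<open>H\<close> to be a subspace lets the statement cover both the classical Riesz theorem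
  (\<open>H\<close> the whole space) and orthogonal projections (\<open>f\<close> an inner product).
\<close>

lemma Riesz_closed_subspace:
  fixes f :: "'a::{real_inner, complete_space} \<Rightarrow> real"
  assumes H: "subspace H" "closed H" and f: "bounded_linear f"
  shows "\<exists>y\<in>H. \<forall>x\<in>H. f x = inner x y"
proof -
  interpret f: bounded_linear f by fact
  obtain C where C: "C > 0" "\<And>x. norm (f x) \<le> norm x * C"
    using f.pos_bounded by blast
  define J where "J = (\<lambda>x. inner x x - 2 * f x)"
  define m where "m = Inf (J ` H)"
  have lower: "- C\<^sup>2 \<le> J x" for x
  proof -
    have "0 \<le> (norm x - C)\<^sup>2" by simp
    then have "2 * (norm x * C) - C\<^sup>2 \<le> inner x x"
      by (simp add: power2_diff power2_norm_eq_inner algebra_simps)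
    then show ?thesis using C(2)[of x] by (simp add: J_def)
  qed
  then have bdd: "bdd_below (J ` H)" by (intro bdd_belowI[of _ "- C\<^sup>2"]) auto
  have m_le: "m \<le> J x" if "x \<in> H" for x
    unfolding m_def using bdd that by (intro cInf_lower) auto
  have "H \<noteq> {}" using H(1) by (auto simp: subspace_def)
  then have "\<exists>x\<in>H. J x < m + 1 / real (Suc n)" for n
    using cInf_lessD[of "J ` H" "m + 1 / real (Suc n)"] by (auto simp: m_def)
  then obtain X where X: "\<And>n. X n \<in> H" "\<And>n. J (X n) < m + 1 / real (Suc n)"
    by metis
  have par: "(norm (x - y))\<^sup>2 \<le> 2 * (J x - m) + 2 * (J y - m)" if "x \<in> H" "y \<in> H" for x y
  proof -
    have "(1/2) *\<^sub>R (x + y) \<in> H" using H(1) that by (simp add: subspace_def)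
    then have "m \<le> J ((1/2) *\<^sub>R (x + y))" by (rule m_le)
    \<comment> \<open>the parallelogram law; the linear part of \<open>J\<close> cancels\<close>
    moreover have "(norm (x - y))\<^sup>2 = 2 * J x + 2 * J y - 4 * J ((1/2) *\<^sub>R (x + y))"
      by (simp add: J_def f.scaleR f.add power2_norm_eq_inner inner_add inner_diff
          inner_commute algebra_simps)
    ultimately show ?thesis by simp
  qed
  have "Cauchy X"
  proof (rule CauchyI)
    fix e :: real assume e: "e > 0"
    obtain N where N: "1 / real (Suc N) < e\<^sup>2 / 4"
      using e nat_approx_posE[of "e\<^sup>2 / 4"] by auto
    have small: "J (X n) - m < e\<^sup>2 / 4" if "n \<ge> N" for n
    proof -
      have "1 / real (Suc n) \<le> 1 / real (Suc N)" using that by (simp add: frac_le)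
      then show ?thesis using X(2)[of n] N by linarith
    qed
    have "norm (X i - X j) < e" if "i \<ge> N" "j \<ge> N" for i j
    proof -
      note par[OF X(1) X(1), of i j]
      also have "2 * (J (X i) - m) + 2 * (J (X j) - m) < 2 * (e\<^sup>2 / 4) + 2 * (e\<^sup>2 / 4)"
        using small[OF that(1)] small[OF that(2)] by (intro add_strict_mono) simp_all
      finally have "(norm (X i - X j))\<^sup>2 < e\<^sup>2" by simp
      then show ?thesis using e by (simp add: power2_less_imp_less)
    qed
    then show "\<exists>M. \<forall>i\<ge>M. \<forall>j\<ge>M. norm (X i - X j) < e" by blast
  qed
  then obtain y where y: "X \<longlonglongrightarrow> y"
    using Cauchy_convergent convergentD by blast
  have yH: "y \<in> H" using H(2) X(1) y closed_sequentially by blast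
  have "(\<lambda>n. J (X n)) \<longlonglongrightarrow> J y"
    unfolding J_def by (intro tendsto_intros f.tendsto y)
  moreover have "(\<lambda>n. m + 1 / real (Suc n)) \<longlonglongrightarrow> m"
    using tendsto_add[OF tendsto_const[of m] LIMSEQ_inverse_real_of_nat] by (simp add: inverse_eq_divide)
  ultimately have Jy: "J y \<le> m"
    using X(2) by (intro LIMSEQ_le) (auto intro!: less_imp_le)
  have "f v = inner v y" if v: "v \<in> H" for v
  proof (cases "v = 0")
    case False
    define b where "b = inner v y - f v"
    \<comment> \<open>the minimum of \<open>J\<close> along the line \<open>y + t v\<close>\<close>
    define t where "t = - b / inner v v"
    have pos: "inner v v > 0" using False by simp
    have "y + t *\<^sub>R v \<in> H" using H(1) yH v by (simp add: subspace_def)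
    then have "J y \<le> J (y + t *\<^sub>R v)" using m_le Jy by fastforce
    also have "\<dots> = J y + (t * t * inner v v + 2 * t * b)"
      by (simp add: J_def b_def f.scaleR f.add inner_add inner_commute algebra_simps)
    also have "t * t * inner v v + 2 * t * b = - (b\<^sup>2 / inner v v)"
      using pos by (simp add: t_def field_simps power2_eq_square)
    finally have "b\<^sup>2 \<le> 0" using pos by (simp add: divide_le_0_iff)
    then show ?thesis by (simp add: b_def)
  qed (simp add: f.zero)
  then show ?thesis using yH by blast
qed

lemma hilbert_subspaceD:
  assumes "hilbert_subspace H"
  shows "subspace H" "closed H" "x \<in> H \<Longrightarrow> c *\<^sub>C x \<in> H"
  using assms by (auto simp: hilbert_subspace_def csubspace_def)

lemma bop_scaleC: "T \<in> bop H \<Longrightarrow> blinfun_apply T (c *\<^sub>C x) = c *\<^sub>C blinfun_apply T x"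
  and bop_range: "T \<in> bop H \<Longrightarrow> blinfun_apply T x \<in> H"
  and bop_orthogonal: "T \<in> bop H \<Longrightarrow> (\<And>y. y \<in> H \<Longrightarrow> cinner x y = 0) \<Longrightarrow> blinfun_apply T x = 0"
  by (auto simp: bop_def)

lemma orthogonal_projection:
  assumes H: "hilbert_subspace (H :: 'a::chilbert_space set)"
  obtains P where "P \<in> bop H" "\<And>x. x \<in> H \<Longrightarrow> blinfun_apply P x = x"
    "\<And>x y. y \<in> H \<Longrightarrow> cinner (x - blinfun_apply P x) y = 0"
    "\<And>x. norm (blinfun_apply P x) \<le> norm x"
proof -
  note sub = hilbert_subspaceD[OF H]
  have "\<forall>u. \<exists>y\<in>H. \<forall>x\<in>H. inner x u = inner x y"
    by (intro allI Riesz_closed_subspace sub bounded_linear_inner_left)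
  then obtain p where pH: "\<And>u. p u \<in> H" and p: "\<And>u x. x \<in> H \<Longrightarrow> inner x u = inner x (p u)"
    by metis
  have orth: "cinner (u - p u) y = 0" if "y \<in> H" for u y
  proof -
    have "inner (u - p u) v = 0" if "v \<in> H" for v
      using p[OF that, of u] by (simp add: inner_commute inner_diff_right)
    \<comment> \<open>orthogonality to \<open>\<i> y\<close> upgrades real orthogonality to complex orthogonality\<close>
    moreover have "Im (cinner (u - p u) y) = inner (u - p u) (\<i> *\<^sub>C y)"
      by (simp add: inner_eq_Re_cinner cinner_scaleC_right)
    ultimately show ?thesis
      using sub(3)[OF \<open>y \<in> H\<close>] \<open>y \<in> H\<close> by (simp add: complex_eq_iff inner_eq_Re_cinner)
  qed
  have uniq: "p u = y" if "y \<in> H" "\<And>z. z \<in> H \<Longrightarrow> cinner (u - y) z = 0" for u y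
  proof -
    have d: "p u - y \<in> H" using pH that(1) sub(1) by (simp add: subspace_diff)
    have "p u - y = (u - y) - (u - p u)" by simp
    then have "cinner (p u - y) (p u - y) = cinner (u - y) (p u - y) - cinner (u - p u) (p u - y)"
      by (metis cinner_diff_left)
    then have "cinner (p u - y) (p u - y) = 0" using d that(2) orth by simp
    then show ?thesis by (simp add: cinner_self)
  qed
  have add: "p (u + v) = p u + p v" for u v
  proof (rule uniq)
    show "p u + p v \<in> H" using pH sub(1) by (simp add: subspace_add)
    show "cinner (u + v - (p u + p v)) z = 0" if "z \<in> H" for z
      unfolding add_diff_add cinner_add_left using orth[OF that] by simp
  qed
  have scale: "p (c *\<^sub>C u) = c *\<^sub>C p u" for c u
  proof (rule uniq)
    show "c *\<^sub>C p u \<in> H" using pH sub(3) by blast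
    have "c *\<^sub>C u - c *\<^sub>C p u = c *\<^sub>C (u - p u)"
      by (metis add_diff_cancel_right' diff_add_cancel scaleC_add_right)
    then show "cinner (c *\<^sub>C u - c *\<^sub>C p u) z = 0" if "z \<in> H" for z
      using orth[OF that] by (simp only: cinner_scaleC_left mult_zero_right)
  qed
  have norm: "norm (p u) \<le> norm u" for u
  proof -
    have "norm (p u) * norm (p u) = inner (p u) u"
      using p[OF pH[of u], of u] power2_norm_eq_inner[of "p u"] by (simp add: power2_eq_square)
    also have "\<dots> \<le> norm (p u) * norm u" by (rule norm_cauchy_schwarz)
    finally show ?thesis
      by (cases "p u = 0") (simp_all add: mult_le_cancel_left)
  qed
  have "bounded_linear p"
  proof (rule bounded_linear_intro[where K = 1])
    show "p (r *\<^sub>R x) = r *\<^sub>R p x" for r x by (simp only: scaleR_scaleC scale)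
  qed (use add norm in simp_all)
  then have ap: "blinfun_apply (Blinfun p) = p" by (rule bounded_linear_Blinfun_apply)
  show ?thesis
  proof (rule that[of "Blinfun p"])
    have "p x = 0" if "\<And>y. y \<in> H \<Longrightarrow> cinner x y = 0" for x
      using that sub(1) by (intro uniq) (simp_all add: subspace_0)
    then show "Blinfun p \<in> bop H" using scale pH by (simp add: bop_def ap)
    show "blinfun_apply (Blinfun p) x = x" if "x \<in> H" for x
      unfolding ap using that by (intro uniq) auto
  qed (use orth norm in \<open>simp_all add: ap\<close>)
qed

text \<open>
  The unit is a definite description, so it is meaningful only because the orthogonal projection
  exists and is the only operator in \<open>bop H\<close> that fixes \<open>H\<close>.
\<close>

lemma idop_apply:
  assumes H: "hilbert_subspace H" and x: "x \<in> H"
  shows "blinfun_apply (idop H) x = x"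
proof -
  obtain P where P: "P \<in> bop H" "\<And>x. x \<in> H \<Longrightarrow> blinfun_apply P x = x"
    "\<And>x y. y \<in> H \<Longrightarrow> cinner (x - blinfun_apply P x) y = 0"
    using orthogonal_projection[OF H] by metis
  have uniq: "Q = P" if "Q \<in> bop H" "\<And>x. x \<in> H \<Longrightarrow> blinfun_apply Q x = x" for Q
  proof (rule blinfun_eqI)
    fix x
    have "blinfun_apply Q (x - blinfun_apply P x) = 0"
      by (intro bop_orthogonal[OF that(1)] P(3))
    then show "blinfun_apply Q x = blinfun_apply P x"
      using that(2) bop_range[OF P(1)] by (simp add: blinfun.diff_right)
  qed
  have "idop H \<in> bop H \<and> (\<forall>x\<in>H. blinfun_apply (idop H) x = x)"
    unfolding idop_def
  proof (rule theI[of _ P])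
    show "P \<in> bop H \<and> (\<forall>x\<in>H. blinfun_apply P x = x)" using P(1,2) by simp
    show "Q = P" if "Q \<in> bop H \<and> (\<forall>x\<in>H. blinfun_apply Q x = x)" for Q
      by (rule uniq) (use that in simp_all)
  qed
  then show ?thesis using x by simp
qed

lemma hilbert_subspace_UNIV: "hilbert_subspace (UNIV :: 'k::chilbert_space set)"
  by (simp add: hilbert_subspace_def csubspace_def)

text \<open>
  Operators in \<open>bop H\<close> vanish on the orthogonal complement of \<open>H\<close>, so the projection onto \<open>H\<close> carries
  a bound on \<open>H\<close> to the ambient space.
\<close>

lemma norm_le_on_subspace:
  assumes H: "hilbert_subspace H" and T: "T \<in> bop H" and t: "t \<ge> 0"
    and le: "\<And>x. x \<in> H \<Longrightarrow> norm (blinfun_apply T x) \<le> t * norm x"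
  shows "norm T \<le> t"
proof (rule norm_blinfun_bound[OF t])
  fix x
  obtain P where P: "P \<in> bop H" "\<And>x y. y \<in> H \<Longrightarrow> cinner (x - blinfun_apply P x) y = 0"
    "\<And>x. norm (blinfun_apply P x) \<le> norm x"
    using orthogonal_projection[OF H] by metis
  have "blinfun_apply T (x - blinfun_apply P x) = 0"
    by (intro bop_orthogonal[OF T] P(2))
  then have "blinfun_apply T x = blinfun_apply T (blinfun_apply P x)"
    by (simp add: blinfun.diff_right)
  also have "norm \<dots> \<le> t * norm (blinfun_apply P x)"
    using le bop_range[OF P(1)] by blast
  also have "\<dots> \<le> t * norm x" using P(3) t by (simp add: mult_left_mono)
  finally show "norm (blinfun_apply T x) \<le> t * norm x" .
qed

text \<open>
  For fixed \<open>x\<close> the map \<open>z \<mapsto> Re B(x, z)\<close> is represented by a vector, which is the value of the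
  operator at \<open>x\<close>; it is linear in \<open>x\<close> because representing vectors are unique.
\<close>

lemma operator_of_form:
  fixes B :: "'k::chilbert_space \<Rightarrow> 'k \<Rightarrow> complex"
  assumes add1: "\<And>x y z. B (x + y) z = B x z + B y z"
    and scale1: "\<And>c x z. B (c *\<^sub>C x) z = c * B x z"
    and add2: "\<And>x y z. B x (y + z) = B x y + B x z"
    and scale2: "\<And>c x z. B x (c *\<^sub>C z) = cnj c * B x z"
    and bound: "\<And>x z. cmod (B x z) \<le> C * norm x * norm z" and C: "C \<ge> 0"
  obtains T where "T \<in> bop UNIV" "norm T \<le> C" "\<And>x z. cinner (blinfun_apply T x) z = B x z"
proof -
  have "\<exists>y. \<forall>z. B x z = cinner y z" for x
  proof -
    have "bounded_linear (\<lambda>z. Re (B x z))"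
    proof (rule bounded_linear_intro[where K = "C * norm x"])
      show "norm (Re (B x z)) \<le> norm z * (C * norm x)" for z
        using bound[of x z] abs_Re_le_cmod[of "B x z"] by (simp add: mult_ac)
      show "Re (B x (r *\<^sub>R z)) = r *\<^sub>R Re (B x z)" for r z
        unfolding scaleR_scaleC[of r z] scale2 by simp
    qed (simp add: add2)
    from Riesz_closed_subspace[OF subspace_UNIV closed_UNIV this]
    obtain y where y: "\<And>z. Re (B x z) = inner z y" by auto
    have "B x z = cinner y z" for z
    proof (rule complex_eqI)
      show "Re (B x z) = Re (cinner y z)"
        by (metis y inner_commute inner_eq_Re_cinner)
      show "Im (B x z) = Im (cinner y z)"
        using y[of "\<i> *\<^sub>C z"] inner_commute[of y "\<i> *\<^sub>C z"]
        by (simp add: scale2 inner_eq_Re_cinner cinner_scaleC_right)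
    qed
    then show ?thesis by blast
  qed
  then obtain t where t: "\<And>x z. B x z = cinner (t x) z" by metis
  have add: "t (x + y) = t x + t y" for x y
    by (rule cinner_ext) (simp add: cinner_add_left add1 flip: t)
  have scale: "t (c *\<^sub>C x) = c *\<^sub>C t x" for c x
    by (rule cinner_ext) (simp add: cinner_scaleC_left scale1 flip: t)
  have norm: "norm (t x) \<le> C * norm x" for x
  proof -
    have "norm (t x) * norm (t x) = cmod (B x (t x))"
      by (simp add: t cinner_self power2_eq_square norm_mult)
    also have "\<dots> \<le> C * norm x * norm (t x)" by (rule bound)
    finally show ?thesis
      using C by (cases "t x = 0") (simp_all add: mult_le_cancel_right)
  qed
  have "bounded_linear t"
  proof (rule bounded_linear_intro[where K = C])
    show "t (r *\<^sub>R x) = r *\<^sub>R t x" for r x by (simp only: scaleR_scaleC scale)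
    show "norm (t x) \<le> norm x * C" for x using norm[of x] by (simp add: mult.commute)
  qed (rule add)
  then have ap: "blinfun_apply (Blinfun t) = t" by (rule bounded_linear_Blinfun_apply)
  show ?thesis
  proof (rule that[of "Blinfun t"])
    have "t x = 0" if "\<And>y. cinner x y = 0" for x
      using that cinner_ext[of x 0] norm[of 0] norm[of x] by simp
    then show "Blinfun t \<in> bop UNIV" by (simp add: bop_def ap scale)
    show "norm (Blinfun t) \<le> C" using norm C by (intro norm_blinfun_bound) (simp_all add: ap)
  qed (simp add: ap t)
qed

section \<open>Contractivity of ucp maps\<close>

lemma clinear_onD:
  assumes "clinear_on V W f"
  shows "x \<in> V \<Longrightarrow> f x \<in> W"
    and "x \<in> V \<Longrightarrow> y \<in> V \<Longrightarrow> f (x + y) = f x + f y"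
    and "x \<in> V \<Longrightarrow> f (c *\<^sub>C x) = c *\<^sub>C f x"
  using assms by (auto simp: clinear_on_def)

lemma csubspaceD:
  assumes "csubspace V"
  shows "subspace V" and "x \<in> V \<Longrightarrow> c *\<^sub>C x \<in> V"
  using assms by (auto simp: csubspace_def)

lemma diff_eq_scaleC: "x - y = x + (- 1) *\<^sub>C y" for x :: "'a::complex_vector"
  using scaleR_scaleC[of "- 1" y] by simp

lemma clinear_on_diff:
  assumes "clinear_on V W f" "csubspace V" "x \<in> V" "y \<in> V"
  shows "f (x - y) = f x - f y"
  using clinear_onD(2,3)[OF assms(1)] csubspaceD(2)[OF assms(2)] assms(3,4)
  by (simp only: diff_eq_scaleC)

lemma clinear_on_zero: "clinear_on V W f \<Longrightarrow> csubspace V \<Longrightarrow> f 0 = 0"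
  using clinear_on_diff[of V W f 0 0] csubspaceD(1)[of V] by (simp add: subspace_0)

lemma sum_lessThan_2: "(\<Sum>i<2. f i) = f 0 + f (1::nat)" for f :: "nat \<Rightarrow> 'a::comm_monoid_add"
  by (simp add: numeral_2_eq_2)

text \<open>
  How the hypotheses arise: \<open>b\<close> and \<open>c\<close> are the off-diagonal terms of a positive \<open>2 \<times> 2\<close> block matrix,
  evaluated at \<open>(x, y)\<close> and at \<open>(\<i> x, y)\<close>.  Both values are real, and the two equations for the imaginary
  parts together say that the matrix is hermitian.
\<close>

lemma nonneg_Reals_rotation_imp_cnj:
  assumes "a + b + c \<in> \<real>\<^sub>\<ge>\<^sub>0" "a - \<i> * b + \<i> * c \<in> \<real>\<^sub>\<ge>\<^sub>0" "a \<in> \<real>"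
  shows "c = cnj b"
  using assms by (auto simp: complex_nonneg_Reals_iff complex_is_Real_iff complex_eq_iff)

text \<open>
  The classical argument by \<open>2\<close>-positivity: for \<open>t = \<parallel>T\<parallel>\<close> the block matrix with rows \<open>(t, T)\<close> and \<open>(T\<^sup>*, t)\<close>
  is positive, so its image under \<open>\<phi>\<close> is positive, and this in turn bounds \<open>\<parallel>\<phi>(T)\<parallel>\<close> by \<open>t\<close>.  For \<open>T = 0\<close>
  the last step would divide by \<open>0\<close>, whence the case distinction.
\<close>

lemma ucp_map_norm_le:
  fixes \<phi> :: "('h::chilbert_space \<Rightarrow>\<^sub>L 'h) \<Rightarrow> ('g::chilbert_space \<Rightarrow>\<^sub>L 'g)"
  assumes H: "hilbert_subspace H" and G: "hilbert_subspace G"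
    and E: "operator_system H E" and Y: "Y \<subseteq> bop G"
    and ucp: "ucp_map H E G Y \<phi>" and T: "T \<in> E"
  shows "norm (\<phi> T) \<le> norm T"
proof (cases "T = 0")
  case True
  have "\<phi> 0 = 0"
    using ucp E clinear_on_zero unfolding ucp_map_def operator_system_def by blast
  then show ?thesis using True by simp
next
  case False
  define t where "t = norm T"
  have t: "t > 0" using False by (simp add: t_def)
  have lin: "clinear_on E Y \<phi>" and unit: "\<phi> (idop H) = idop G"
    and cp: "completely_positive H E G \<phi>"
    using ucp by (auto simp: ucp_map_def)
  have cs: "csubspace E" and one: "idop H \<in> E"
    using E by (auto simp: operator_system_def)
  obtain S where S: "S \<in> E" "\<And>x y. cinner (blinfun_apply T x) y = cinner x (blinfun_apply S y)"
    using E T unfolding operator_system_def by metis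
  define M where "M = (\<lambda>i j::nat. if i = j then complex_of_real t *\<^sub>C idop H else if i = 0 then T else S)"
  have M: "M i j \<in> E" for i j
    using T S(1) one csubspaceD(2)[OF cs] by (simp add: M_def)
  have "mat_pos H 2 M"
    unfolding mat_pos_def
  proof (intro allI impI)
    fix v :: "nat \<Rightarrow> 'h" assume v: "\<forall>i<2. v i \<in> H"
    define a where "a = cinner (blinfun_apply T (v 1)) (v 0)"
    have S_eq: "cinner (blinfun_apply S (v 0)) (v 1) = cnj a"
      unfolding a_def S(2) by (metis cinner_commute)
    have "cmod a \<le> norm (blinfun_apply T (v 1)) * norm (v 0)"
      unfolding a_def by (rule norm_cinner_le)
    also have "\<dots> \<le> t * norm (v 1) * norm (v 0)"
      unfolding t_def by (intro mult_right_mono norm_blinfun) simp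
    finally have "2 * cmod a \<le> t * (2 * norm (v 1) * norm (v 0))" by simp
    also have "\<dots> \<le> t * ((norm (v 0))\<^sup>2 + (norm (v 1))\<^sup>2)"
      using t sum_squares_bound[of "norm (v 1)" "norm (v 0)"] by (intro mult_left_mono) simp_all
    finally have "0 \<le> t * (norm (v 0))\<^sup>2 + t * (norm (v 1))\<^sup>2 + 2 * Re a"
      using abs_Re_le_cmod[of a] by (simp add: algebra_simps)
    moreover have "(\<Sum>i<2. \<Sum>j<2. cinner (blinfun_apply (M i j) (v j)) (v i)) =
      complex_of_real (t * (norm (v 0))\<^sup>2 + t * (norm (v 1))\<^sup>2 + 2 * Re a)"
      using v idop_apply[OF H]
      by (simp add: sum_lessThan_2 M_def scaleC_blinfun.rep_eq cinner_scaleC_left cinner_self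
          S_eq complex_eq_iff flip: a_def del: One_nat_def)
    ultimately show "(\<Sum>i<2. \<Sum>j<2. cinner (blinfun_apply (M i j) (v j)) (v i)) \<in> \<real>\<^sub>\<ge>\<^sub>0"
      by (simp only: nonneg_Reals_of_real_iff)
  qed
  then have pos: "mat_pos G 2 (\<lambda>i j. \<phi> (M i j))"
    using cp M unfolding completely_positive_def by blast
  have form: "complex_of_real (t * (norm x)\<^sup>2 + t * (norm y)\<^sup>2) +
      cinner (blinfun_apply (\<phi> T) y) x + cinner (blinfun_apply (\<phi> S) x) y \<in> \<real>\<^sub>\<ge>\<^sub>0"
    if "x \<in> G" "y \<in> G" for x y
  proof -
    define v where "v = (\<lambda>i::nat. if i = 0 then x else y)"
    have diag: "\<phi> (complex_of_real t *\<^sub>C idop H) = complex_of_real t *\<^sub>C idop G"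
      using clinear_onD(3)[OF lin one] unit by simp
    have "(\<Sum>i<2. \<Sum>j<2. cinner (blinfun_apply (\<phi> (M i j)) (v j)) (v i)) \<in> \<real>\<^sub>\<ge>\<^sub>0"
      using pos that unfolding mat_pos_def by (simp add: v_def)
    also have "(\<Sum>i<2. \<Sum>j<2. cinner (blinfun_apply (\<phi> (M i j)) (v j)) (v i)) =
      complex_of_real (t * (norm x)\<^sup>2 + t * (norm y)\<^sup>2) +
        cinner (blinfun_apply (\<phi> T) y) x + cinner (blinfun_apply (\<phi> S) x) y"
      using that idop_apply[OF G]
      by (simp add: sum_lessThan_2 M_def v_def diag scaleC_blinfun.rep_eq cinner_scaleC_left cinner_self)
    finally show ?thesis .
  qed
  have phiT: "\<phi> T \<in> bop G" and phiS: "\<phi> S \<in> bop G"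
    using clinear_onD(1)[OF lin] T S(1) Y by auto
  have adj: "cinner (blinfun_apply (\<phi> S) x) y = cnj (cinner (blinfun_apply (\<phi> T) y) x)"
    if xy: "x \<in> G" "y \<in> G" for x y
  proof -
    define a where "a = complex_of_real (t * (norm x)\<^sup>2 + t * (norm y)\<^sup>2)"
    \<comment> \<open>compare the values of the form at \<open>(x, y)\<close> and \<open>(\<i> x, y)\<close>\<close>
    have "\<i> *\<^sub>C x \<in> G" using hilbert_subspaceD(3)[OF G xy(1)] .
    from form[OF this xy(2)]
    have "a - \<i> * cinner (blinfun_apply (\<phi> T) y) x + \<i> * cinner (blinfun_apply (\<phi> S) x) y \<in> \<real>\<^sub>\<ge>\<^sub>0"
      by (simp add: a_def bop_scaleC[OF phiS] cinner_scaleC_left cinner_scaleC_right norm_scaleC)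
    with form[OF xy] show ?thesis
      unfolding a_def[symmetric] by (rule nonneg_Reals_rotation_imp_cnj) (simp add: a_def)
  qed
  have "norm (\<phi> T) \<le> t"
  proof (rule norm_le_on_subspace[OF G phiT])
    fix y assume y: "y \<in> G"
    define z where "z = blinfun_apply (\<phi> T) y"
    \<comment> \<open>minimizes the quadratic form of the image matrix for given \<open>y\<close>\<close>
    define x where "x = complex_of_real (- 1 / t) *\<^sub>C z"
    have "z \<in> G" unfolding z_def by (rule bop_range[OF phiT])
    then have x: "x \<in> G" unfolding x_def by (rule hilbert_subspaceD(3)[OF G])
    have "\<bar>- 1 / t\<bar> = 1 / t" using t by simp
    then have nx: "norm x = norm z / t" by (simp only: x_def norm_scaleC norm_of_real) simp
    have zx: "cinner z x = complex_of_real (- 1 / t * (norm z)\<^sup>2)"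
      by (simp only: x_def cinner_scaleC_right cinner_self complex_cnj_complex_of_real of_real_mult)
    have "complex_of_real (t * (norm x)\<^sup>2 + t * (norm y)\<^sup>2) +
        complex_of_real (- 1 / t * (norm z)\<^sup>2) + complex_of_real (- 1 / t * (norm z)\<^sup>2) \<in> \<real>\<^sub>\<ge>\<^sub>0"
      using form[OF x y] unfolding adj[OF x y] z_def[symmetric] zx complex_cnj_complex_of_real .
    then have "0 \<le> t * (norm x)\<^sup>2 + t * (norm y)\<^sup>2 + - 1 / t * (norm z)\<^sup>2 + - 1 / t * (norm z)\<^sup>2"
      by (simp only: nonneg_Reals_of_real_iff flip: of_real_add)
    also have "t * (norm x)\<^sup>2 = 1 / t * (norm z)\<^sup>2"
      using t by (simp add: nx power_divide power2_eq_square)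
    finally have "1 / t * (norm z)\<^sup>2 \<le> t * (norm y)\<^sup>2" by simp
    then have "t * (1 / t * (norm z)\<^sup>2) \<le> t * (t * (norm y)\<^sup>2)"
      using t by (intro mult_left_mono) simp_all
    then have "(norm z)\<^sup>2 \<le> (t * norm y)\<^sup>2"
      using t by (simp add: power_mult_distrib power2_eq_square mult_ac)
    then show "norm (blinfun_apply (\<phi> T) y) \<le> t * norm y"
      unfolding z_def by (rule power2_le_imp_le) (use t in simp)
  qed (use t in simp)
  then show ?thesis by (simp add: t_def)
qed

section \<open>Compactness of the BW-topology\<close>

lemma
  assumes "\<phi> \<in> UCP H E"
  shows UCP_extensional: "\<phi> \<in> extensional E"
    and UCP_ucp_map: "ucp_map H E UNIV (bop UNIV) \<phi>"
    and UCP_clinear_on: "clinear_on E (bop UNIV) \<phi>"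
  using assms by (auto simp: UCP_def ucp_map_def)

lemma UCP_norm_le:
  assumes "hilbert_subspace H" "operator_system H E" "\<phi> \<in> UCP H E" "x \<in> E"
  shows "norm (\<phi> x) \<le> norm x"
  using ucp_map_norm_le[OF assms(1) hilbert_subspace_UNIV assms(2) _ UCP_ucp_map[OF assms(3)] assms(4)]
  by simp

lemma UCP_subset_bounded_maps:
  assumes "hilbert_subspace H" "operator_system H E"
  shows "UCP H E \<subseteq> bounded_maps E"
proof
  fix \<phi> assume "\<phi> \<in> UCP H E"
  moreover from this have "\<forall>x\<in>E. norm (\<phi> x) \<le> 1 * norm x"
    by (simp add: UCP_norm_le[OF assms])
  ultimately show "\<phi> \<in> bounded_maps E"
    unfolding bounded_maps_def using UCP_extensional UCP_clinear_on by blast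
qed

text \<open>
  The functional belongs to the trace class operator of rank one given by \<open>h\<close> and \<open>h'\<close>, i.e. to
  sequences whose only nonzero entries are these vectors.
\<close>

lemma matrix_coefficient_in_predual:
  assumes "x \<in> E"
  shows "(\<lambda>L. cinner (blinfun_apply (L x) h) h') \<in> weak_star_predual E"
proof -
  define a where "a = (\<lambda>j::nat. if j = 0 then h else 0)"
  define b where "b = (\<lambda>j::nat. if j = 0 then h' else 0)"
  have "summable (\<lambda>j. (norm (a j))\<^sup>2)" "summable (\<lambda>j. (norm (b j))\<^sup>2)"
    by (rule summable_finite[of "{0}"]; simp add: a_def b_def)+
  then have "(\<lambda>T. \<Sum>j. cinner (blinfun_apply T (a j)) (b j)) \<in> bop_predual"
    unfolding bop_predual_def by blast
  moreover have "(\<Sum>j. cinner (blinfun_apply T (a j)) (b j)) = cinner (blinfun_apply T h) h'" for T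
    using suminf_finite[of "{0}" "\<lambda>j. cinner (blinfun_apply T (a j)) (b j)"]
    by (simp add: a_def b_def)
  ultimately have pre: "(\<lambda>T. cinner (blinfun_apply T h) h') \<in> bop_predual" by simp
  define z where "z = (\<lambda>L::('a \<Rightarrow>\<^sub>L 'a) \<Rightarrow> ('b \<Rightarrow>\<^sub>L 'b). cinner (blinfun_apply (L x) h) h')"
  have z: "z \<in> elementary_functionals E"
    unfolding elementary_functionals_def z_def
    by (rule CollectI, rule exI[of _ x], rule exI[of _ "\<lambda>T. cinner (blinfun_apply T h) h'"])
      (simp add: assms pre)
  have "z \<in> weak_star_predual E"
    unfolding weak_star_predual_def
  proof (intro CollectI allI impI)
    fix \<epsilon> :: real
    show "\<exists>F c. finite F \<and> F \<subseteq> elementary_functionals E \<and>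
      (\<forall>L\<in>bounded_maps E. \<forall>C\<ge>0. (\<forall>x\<in>E. norm (L x) \<le> C * norm x) \<longrightarrow>
        cmod (z L - (\<Sum>f\<in>F. c f * f L)) \<le> \<epsilon> * C)" if "\<epsilon> > 0"
      by (rule exI[of _ "{z}"], rule exI[of _ "\<lambda>_. 1"]) (use z that in simp)
  qed
  then show ?thesis by (simp add: z_def)
qed

text \<open>
  Coefficients outside of \<open>E\<close> are set to \<open>0\<close>, so that the product space can be the space of all
  functions on triples and carries the topology of its type.
\<close>

definition coefficients ::
  "('h::chilbert_space \<Rightarrow>\<^sub>L 'h) set \<Rightarrow> (('h \<Rightarrow>\<^sub>L 'h) \<Rightarrow> ('k::chilbert_space \<Rightarrow>\<^sub>L 'k)) \<Rightarrow>
   ('h \<Rightarrow>\<^sub>L 'h) \<times> 'k \<times> 'k \<Rightarrow> complex" where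
  "coefficients E \<phi> = (\<lambda>(x, h, h'). if x \<in> E then cinner (blinfun_apply (\<phi> x) h) h' else 0)"

text \<open>
  The algebraic conditions that single out the coefficients of ucp maps.  Each of them involves
  only finitely many coefficients, which makes the set closed under pointwise limits.
\<close>

definition ucp_coefficients ::
  "'h::chilbert_space set \<Rightarrow> ('h \<Rightarrow>\<^sub>L 'h) set \<Rightarrow>
   (('h \<Rightarrow>\<^sub>L 'h) \<times> 'k::chilbert_space \<times> 'k \<Rightarrow> complex) set" where
  "ucp_coefficients H E = {p.
     (\<forall>x. x \<notin> E \<longrightarrow> (\<forall>h h'. p (x, h, h') = 0)) \<and>
     (\<forall>x y. x \<in> E \<longrightarrow> y \<in> E \<longrightarrow> (\<forall>h h'. p (x + y, h, h') = p (x, h, h') + p (y, h, h'))) \<and>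
     (\<forall>x. x \<in> E \<longrightarrow> (\<forall>c h h'. p (c *\<^sub>C x, h, h') = c * p (x, h, h'))) \<and>
     (\<forall>x. x \<in> E \<longrightarrow> (\<forall>g h h'. p (x, g + h, h') = p (x, g, h') + p (x, h, h'))) \<and>
     (\<forall>x. x \<in> E \<longrightarrow> (\<forall>c h h'. p (x, c *\<^sub>C h, h') = c * p (x, h, h'))) \<and>
     (\<forall>x. x \<in> E \<longrightarrow> (\<forall>h g h'. p (x, h, g + h') = p (x, h, g) + p (x, h, h'))) \<and>
     (\<forall>x. x \<in> E \<longrightarrow> (\<forall>c h h'. p (x, h, c *\<^sub>C h') = cnj c * p (x, h, h'))) \<and>
     (\<forall>h h'. p (idop H, h, h') = cinner h h') \<and>
     (\<forall>m T. (\<forall>i<m. \<forall>j<m. T i j \<in> E) \<longrightarrow> mat_pos H m T \<longrightarrow>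
        (\<forall>v. (\<Sum>i<m. \<Sum>j<m. p (T i j, v j, v i)) \<in> \<real>\<^sub>\<ge>\<^sub>0))}"

lemma closed_ucp_coefficients: "closed (ucp_coefficients H E)"
proof -
  have imp: "closed {p. P \<longrightarrow> Q p}" if "closed {p. Q p}"
    for P and Q :: "(('a \<Rightarrow>\<^sub>L 'a) \<times> 'b \<times> 'b \<Rightarrow> complex) \<Rightarrow> bool"
    using that by (cases P) simp_all
  have nonneg: "closed {p. f p \<in> \<real>\<^sub>\<ge>\<^sub>0}" if "continuous_on UNIV f"
    for f :: "(('a \<Rightarrow>\<^sub>L 'a) \<times> 'b \<times> 'b \<Rightarrow> complex) \<Rightarrow> complex"
    using closed_vimage[OF closed_nonneg_Reals_complex that] by (simp add: vimage_def)
  show ?thesis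
    unfolding ucp_coefficients_def
    by (intro closed_Collect_conj closed_Collect_all imp nonneg closed_Collect_eq
        continuous_on_product_coordinates continuous_intros)
qed

text \<open>
  Tychonoff's theorem for a product of closed discs.
\<close>

lemma compact_bounded_functions: "compact {p :: 'i \<Rightarrow> complex. \<forall>i. cmod (p i) \<le> b i}"
proof -
  have "compactin (product_topology (\<lambda>_. euclidean) UNIV) (PiE UNIV (\<lambda>i. cball (0::complex) (b i)))"
    by (simp add: compactin_PiE)
  moreover have "PiE UNIV (\<lambda>i. cball (0::complex) (b i)) = {p. \<forall>i. cmod (p i) \<le> b i}"
    by (auto simp: PiE_UNIV_domain)
  ultimately show ?thesis by (simp add: euclidean_product_topology)
qed

lemma coefficients_inj:
  assumes "\<phi> \<in> extensional E" "\<psi> \<in> extensional E" "coefficients E \<phi> = coefficients E \<psi>"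
  shows "\<phi> = \<psi>"
proof (rule extensionalityI[OF assms(1,2)])
  fix x assume "x \<in> E"
  then have "cinner (blinfun_apply (\<phi> x) h) h' = cinner (blinfun_apply (\<psi> x) h) h'" for h h'
    using fun_cong[OF assms(3), of "(x, h, h')"] by (simp add: coefficients_def)
  then show "\<phi> x = \<psi> x" by (intro blinfun_eqI cinner_ext)
qed

text \<open>
  The right-hand side makes the compactness argument possible, since it is a closed subset of a
  product of discs.  Surjectivity onto it is where operators have to be reconstructed from
  sesquilinear forms; the size of the discs comes from the contractivity of ucp maps.
\<close>

lemma coefficients_UCP:
  assumes H: "hilbert_subspace H" and E: "operator_system H E"
  shows "coefficients E ` (UCP H E :: (_ \<Rightarrow> ('k::chilbert_space \<Rightarrow>\<^sub>L 'k)) set) =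
    ucp_coefficients H E \<inter> {p. \<forall>i. cmod (p i) \<le> norm (fst i) * norm (fst (snd i)) * norm (snd (snd i))}"
    (is "?L = ?R")
proof (intro equalityI subsetI)
  have cs: "csubspace E" and one: "idop H \<in> E"
    using E by (auto simp: operator_system_def)
  have sumE: "x + y \<in> E" if "x \<in> E" "y \<in> E" for x y
    using csubspaceD(1)[OF cs] that by (simp add: subspace_add)
  note scaleE = csubspaceD(2)[OF cs]
  {
    fix p assume "p \<in> ?L"
    then obtain \<phi> :: "_ \<Rightarrow> ('k \<Rightarrow>\<^sub>L 'k)" where phi: "\<phi> \<in> UCP H E" "p = coefficients E \<phi>" by blast
    note lin = clinear_onD[OF UCP_clinear_on[OF phi(1)]]
    have p: "p (x, h, h') = cinner (blinfun_apply (\<phi> x) h) h'" if "x \<in> E" for x h h'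
      using that by (simp add: phi(2) coefficients_def)
    have p0: "p (x, h, h') = 0" if "x \<notin> E" for x h h'
      using that by (simp add: phi(2) coefficients_def)
    have unit: "\<phi> (idop H) = idop UNIV" and cp: "completely_positive H E UNIV \<phi>"
      using UCP_ucp_map[OF phi(1)] by (auto simp: ucp_map_def)
    have "(\<Sum>i<m. \<Sum>j<m. p (T i j, v j, v i)) \<in> \<real>\<^sub>\<ge>\<^sub>0"
      if T: "\<forall>i<m. \<forall>j<m. T i j \<in> E" "mat_pos H m T" for m T v
    proof -
      have "(\<Sum>i<m. \<Sum>j<m. cinner (blinfun_apply (\<phi> (T i j)) (v j)) (v i)) \<in> \<real>\<^sub>\<ge>\<^sub>0"
        using cp T unfolding completely_positive_def mat_pos_def by simp
      also have "(\<Sum>i<m. \<Sum>j<m. cinner (blinfun_apply (\<phi> (T i j)) (v j)) (v i)) =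
          (\<Sum>i<m. \<Sum>j<m. p (T i j, v j, v i))"
        using T(1) by (intro sum.cong refl) (simp add: p)
      finally show ?thesis .
    qed
    moreover have "p (idop H, h, h') = cinner h h'" for h h'
      by (simp add: p[OF one] unit idop_apply[OF hilbert_subspace_UNIV])
    ultimately have "p \<in> ucp_coefficients H E"
      unfolding ucp_coefficients_def
      by (simp add: p p0 sumE scaleE lin bop_scaleC[OF lin(1)] plus_blinfun.rep_eq
          scaleC_blinfun.rep_eq blinfun.add_right cinner_add_left cinner_add_right
          cinner_scaleC_left cinner_scaleC_right)
    moreover have "cmod (p (x, h, h')) \<le> norm x * norm h * norm h'" for x h h'
    proof (cases "x \<in> E")
      case True
      have "cmod (p (x, h, h')) \<le> norm (blinfun_apply (\<phi> x) h) * norm h'"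
        unfolding p[OF True] by (rule norm_cinner_le)
      also have "\<dots> \<le> norm (\<phi> x) * norm h * norm h'"
        by (intro mult_right_mono norm_blinfun) simp
      also have "\<dots> \<le> norm x * norm h * norm h'"
        by (intro mult_right_mono UCP_norm_le[OF H E phi(1) True]) simp_all
      finally show ?thesis .
    qed (simp add: p0)
    ultimately show "p \<in> ?R" by simp
  next
    fix p :: "_ \<Rightarrow> complex" assume "p \<in> ?R"
    then have p: "p \<in> ucp_coefficients H E"
      and bd: "\<And>x h h'. cmod (p (x, h, h')) \<le> norm x * norm h * norm h'"
      by auto
    have ex: "\<exists>T. T \<in> bop UNIV \<and> (\<forall>h h'. cinner (blinfun_apply T h) h' = p (x, h, h'))"
      if x: "x \<in> E" for x
    proof -
      obtain T where "T \<in> bop UNIV" "norm T \<le> norm x"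
        "\<And>h h'. cinner (blinfun_apply T h) h' = p (x, h, h')"
      proof (rule operator_of_form[of "\<lambda>h h'. p (x, h, h')" "norm x"])
        show "cmod (p (x, h, h')) \<le> norm x * norm h * norm h'" for h h' by (rule bd)
      qed (use p x in \<open>simp_all add: ucp_coefficients_def\<close>)
      then show ?thesis by blast
    qed
    define \<phi> where "\<phi> = restrict
      (\<lambda>x. SOME T. T \<in> bop UNIV \<and> (\<forall>h h'. cinner (blinfun_apply T h) h' = p (x, h, h'))) E"
    have phi_bop: "\<phi> x \<in> bop UNIV" and phi: "cinner (blinfun_apply (\<phi> x) h) h' = p (x, h, h')"
      if "x \<in> E" for x h h'
      using someI_ex[OF ex[OF that]] that by (auto simp: \<phi>_def)
    have eqI: "S = T" if "\<And>h h'. cinner (blinfun_apply S h) h' = cinner (blinfun_apply T h) h'"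
      for S T :: "'k \<Rightarrow>\<^sub>L 'k"
      using that by (intro blinfun_eqI cinner_ext)
    have "\<phi> (x + y) = \<phi> x + \<phi> y" if "x \<in> E" "y \<in> E" for x y
      by (rule eqI) (use p that sumE in
          \<open>simp add: phi ucp_coefficients_def plus_blinfun.rep_eq cinner_add_left\<close>)
    moreover have "\<phi> (c *\<^sub>C x) = c *\<^sub>C \<phi> x" if "x \<in> E" for c x
      by (rule eqI) (use p that scaleE in
          \<open>simp add: phi ucp_coefficients_def scaleC_blinfun.rep_eq cinner_scaleC_left\<close>)
    moreover have "\<phi> (idop H) = idop UNIV"
      by (rule eqI) (use p one in
          \<open>simp add: phi ucp_coefficients_def idop_apply[OF hilbert_subspace_UNIV]\<close>)
    moreover have "completely_positive H E UNIV \<phi>"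
      unfolding completely_positive_def mat_pos_def[of UNIV]
    proof (intro allI impI)
      fix m T and v :: "nat \<Rightarrow> 'k" assume T: "\<forall>i<m. \<forall>j<m. T i j \<in> E" "mat_pos H m T"
      then have "(\<Sum>i<m. \<Sum>j<m. p (T i j, v j, v i)) \<in> \<real>\<^sub>\<ge>\<^sub>0"
        using p unfolding ucp_coefficients_def by blast
      also have "(\<Sum>i<m. \<Sum>j<m. p (T i j, v j, v i)) =
          (\<Sum>i<m. \<Sum>j<m. cinner (blinfun_apply (\<phi> (T i j)) (v j)) (v i))"
        using T(1) by (intro sum.cong refl) (simp add: phi)
      finally show "(\<Sum>i<m. \<Sum>j<m. cinner (blinfun_apply (\<phi> (T i j)) (v j)) (v i)) \<in> \<real>\<^sub>\<ge>\<^sub>0" .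
    qed
    ultimately have "\<phi> \<in> UCP H E"
      using phi_bop unfolding UCP_def ucp_map_def clinear_on_def
      by (simp add: image_subset_iff) (simp add: \<phi>_def)
    moreover have "p (x, h, h') = coefficients E \<phi> (x, h, h')" for x h h'
      using p by (simp add: coefficients_def phi ucp_coefficients_def)
    then have "p = coefficients E \<phi>" by auto
    ultimately show "p \<in> ?L" by blast
  }
qed

lemma compact_coefficients_UCP:
  assumes "hilbert_subspace H" "operator_system H E"
  shows "compact (coefficients E ` UCP H E)"
  unfolding coefficients_UCP[OF assms]
  by (intro closed_Int_compact closed_ucp_coefficients compact_bounded_functions)

text \<open>
  An elementary functional is a series of coefficients.  It converges uniformly by the Weierstrass
  test, because \<open>\<parallel>\<phi>(x)\<parallel> \<le> \<parallel>x\<parallel>\<close> holds simultaneously for all ucp maps \<open>\<phi>\<close>.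
\<close>

lemma elementary_functional_continuous_on_coefficients:
  fixes f :: "(('h::chilbert_space \<Rightarrow>\<^sub>L 'h) \<Rightarrow> ('k::chilbert_space \<Rightarrow>\<^sub>L 'k)) \<Rightarrow> complex"
  assumes H: "hilbert_subspace H" and E: "operator_system H E"
    and f: "f \<in> elementary_functionals E"
  shows "continuous_on (coefficients E ` UCP H E) (\<lambda>p. f (inv_into (UCP H E) (coefficients E) p))"
proof -
  let ?UCP = "UCP H E :: (_ \<Rightarrow> ('k \<Rightarrow>\<^sub>L 'k)) set"
  define X where "X = coefficients E ` ?UCP"
  define \<Gamma> where "\<Gamma> = inv_into ?UCP (coefficients E)"
  obtain x a b where x: "x \<in> E" and f_eq: "f = (\<lambda>L. \<Sum>j. cinner (blinfun_apply (L x) (a j)) (b j))"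
    and a: "summable (\<lambda>j::nat. (norm (a j))\<^sup>2)" and b: "summable (\<lambda>j. (norm (b j))\<^sup>2)"
    using f unfolding elementary_functionals_def bop_predual_def by blast
  have \<Gamma>: "\<Gamma> p \<in> UCP H E" "coefficients E (\<Gamma> p) = p" if "p \<in> X" for p
    using that unfolding X_def \<Gamma>_def by (rule inv_into_into, rule f_inv_into_f)
  have coeff: "p (x, h, h') = cinner (blinfun_apply (\<Gamma> p x) h) h'" if "p \<in> X" for p h h'
    using fun_cong[OF \<Gamma>(2)[OF that], of "(x, h, h')"] x by (simp add: coefficients_def)
  define m where "m = (\<lambda>j. norm x * (norm (a j))\<^sup>2 + norm x * (norm (b j))\<^sup>2)"
  have "summable m"
    unfolding m_def by (intro summable_add summable_mult a b)
  moreover have "norm (p (x, a j, b j)) \<le> m j" if "p \<in> X" for p j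
  proof -
    have "norm (p (x, a j, b j)) \<le> norm (blinfun_apply (\<Gamma> p x) (a j)) * norm (b j)"
      unfolding coeff[OF that] by (rule norm_cinner_le)
    also have "\<dots> \<le> norm (\<Gamma> p x) * norm (a j) * norm (b j)"
      by (intro mult_right_mono norm_blinfun) simp
    also have "\<dots> \<le> norm x * norm (a j) * norm (b j)"
      by (intro mult_right_mono UCP_norm_le[OF H E \<Gamma>(1)[OF that] x]) simp_all
    also have "\<dots> = norm x * (norm (a j) * norm (b j))" by simp
    also have "\<dots> \<le> norm x * ((norm (a j))\<^sup>2 + (norm (b j))\<^sup>2)"
    proof (rule mult_left_mono)
      have "0 \<le> norm (a j) * norm (b j)" by simp
      then show "norm (a j) * norm (b j) \<le> (norm (a j))\<^sup>2 + (norm (b j))\<^sup>2"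
        using sum_squares_bound[of "norm (a j)" "norm (b j)"] by linarith
    qed simp
    finally show ?thesis by (simp add: m_def distrib_left)
  qed
  ultimately have "uniform_limit X (\<lambda>n p. \<Sum>j<n. p (x, a j, b j)) (\<lambda>p. \<Sum>j. p (x, a j, b j)) sequentially"
    by (intro Weierstrass_m_test)
  moreover have "continuous_on X (\<lambda>p. \<Sum>j<n. p (x, a j, b j))" for n
    by (intro continuous_on_sum continuous_on_subset[OF continuous_on_product_coordinates]) simp
  ultimately have "continuous_on X (\<lambda>p. \<Sum>j. p (x, a j, b j))"
    by (intro uniform_limit_theorem[OF always_eventually]) auto
  then have "continuous_on X (\<lambda>p. f (\<Gamma> p))"
    by (rule continuous_on_eq) (simp add: f_eq coeff)
  then show ?thesis by (simp add: X_def \<Gamma>_def)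
qed

text \<open>
  All ucp maps lie in the unit ball of the bounded maps, where an element of the closed linear span
  is a uniform limit of linear combinations of elementary functionals.
\<close>

lemma predual_functional_continuous_on_coefficients:
  fixes z :: "(('h::chilbert_space \<Rightarrow>\<^sub>L 'h) \<Rightarrow> ('k::chilbert_space \<Rightarrow>\<^sub>L 'k)) \<Rightarrow> complex"
  assumes H: "hilbert_subspace H" and E: "operator_system H E"
    and z: "z \<in> weak_star_predual E"
  shows "continuous_on (coefficients E ` UCP H E) (\<lambda>p. z (inv_into (UCP H E) (coefficients E) p))"
proof -
  let ?UCP = "UCP H E :: (_ \<Rightarrow> ('k \<Rightarrow>\<^sub>L 'k)) set"
  define X where "X = coefficients E ` ?UCP"
  define \<Gamma> where "\<Gamma> = inv_into ?UCP (coefficients E)"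
  define near where "near = (\<lambda>n F c. finite F \<and> F \<subseteq> elementary_functionals E \<and>
     (\<forall>L\<in>bounded_maps E. \<forall>C\<ge>0. (\<forall>x\<in>E. norm (L x) \<le> C * norm x) \<longrightarrow>
        cmod (z L - (\<Sum>f\<in>F. c f * f L)) \<le> 1 / real (Suc n) * C))"
  have "\<exists>F c. near n F c" for n
    unfolding near_def
    by (rule z[unfolded weak_star_predual_def mem_Collect_eq, THEN spec, THEN mp]) simp
  then obtain F c where near: "\<And>n. near n (F n) (c n)" by metis
  then have F: "F n \<subseteq> elementary_functionals E" for n
    by (simp add: near_def)
  have le: "cmod (z (\<Gamma> p) - (\<Sum>f\<in>F n. c n f * f (\<Gamma> p))) \<le> 1 / real (Suc n)" if "p \<in> X" for n p
  proof -
    have "\<Gamma> p \<in> UCP H E"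
      using that unfolding X_def \<Gamma>_def by (rule inv_into_into)
    then have "\<Gamma> p \<in> bounded_maps E" "\<forall>x\<in>E. norm (\<Gamma> p x) \<le> 1 * norm x"
      using subsetD[OF UCP_subset_bounded_maps[OF H E]] by (simp_all add: UCP_norm_le[OF H E])
    moreover have "\<forall>L\<in>bounded_maps E. \<forall>C\<ge>0. (\<forall>x\<in>E. norm (L x) \<le> C * norm x) \<longrightarrow>
        cmod (z L - (\<Sum>f\<in>F n. c n f * f L)) \<le> 1 / real (Suc n) * C"
      using near[of n] unfolding near_def by (elim conjE)
    ultimately have "cmod (z (\<Gamma> p) - (\<Sum>f\<in>F n. c n f * f (\<Gamma> p))) \<le> 1 / real (Suc n) * 1"
      using zero_le_one by blast
    then show ?thesis by simp
  qed
  have "uniform_limit X (\<lambda>n p. \<Sum>f\<in>F n. c n f * f (\<Gamma> p)) (\<lambda>p. z (\<Gamma> p)) sequentially"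
  proof (rule uniform_limitI)
    fix e :: real assume "e > 0"
    then obtain N where N: "1 / real (Suc N) < e" using nat_approx_posE by blast
    have "dist (\<Sum>f\<in>F n. c n f * f (\<Gamma> p)) (z (\<Gamma> p)) < e" if "n \<ge> N" "p \<in> X" for n p
    proof -
      have "dist (\<Sum>f\<in>F n. c n f * f (\<Gamma> p)) (z (\<Gamma> p)) \<le> 1 / real (Suc n)"
        using le[OF that(2)] by (simp add: dist_norm norm_minus_commute)
      also have "\<dots> \<le> 1 / real (Suc N)" using that(1) by (simp add: frac_le)
      finally show ?thesis using N by simp
    qed
    then show "\<forall>\<^sub>F n in sequentially. \<forall>p\<in>X. dist (\<Sum>f\<in>F n. c n f * f (\<Gamma> p)) (z (\<Gamma> p)) < e"
      unfolding eventually_sequentially by blast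
  qed
  moreover have "continuous_on X (\<lambda>p. \<Sum>f\<in>F n. c n f * f (\<Gamma> p))" for n
    unfolding X_def \<Gamma>_def using F
    by (intro continuous_intros elementary_functional_continuous_on_coefficients[OF H E]) auto
  ultimately have "continuous_on X (\<lambda>p. z (\<Gamma> p))"
    by (intro uniform_limit_theorem[OF always_eventually]) auto
  then show ?thesis by (simp add: X_def \<Gamma>_def)
qed

text \<open>
  The inverse of the coefficient map is continuous from the compact set of coefficients onto the set
  of ucp maps: a subbasic open set is the preimage of an open set under a predual functional.
\<close>

lemma compactin_weak_star_UCP:
  assumes H: "hilbert_subspace H" and E: "operator_system H E"
  shows "compactin (weak_star_topology E) (UCP H E :: (_ \<Rightarrow> ('k::chilbert_space \<Rightarrow>\<^sub>L 'k)) set)"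
proof -
  let ?UCP = "UCP H E :: (_ \<Rightarrow> ('k \<Rightarrow>\<^sub>L 'k)) set"
  define X where "X = coefficients E ` ?UCP"
  define \<Gamma> where "\<Gamma> = inv_into ?UCP (coefficients E)"
  have inj: "inj_on (coefficients E) ?UCP"
    by (intro inj_onI coefficients_inj) (auto intro: UCP_extensional)
  have img: "\<Gamma> ` X = ?UCP"
    unfolding X_def \<Gamma>_def using inj by (rule inv_into_image_cancel) simp
  have bdd: "?UCP \<subseteq> bounded_maps E" by (rule UCP_subset_bounded_maps[OF H E])
  have "continuous_map (top_of_set X) (weak_star_topology E) \<Gamma>"
    unfolding weak_star_topology_def
  proof (rule continuous_on_generated_topo)
    fix W :: "(_ \<Rightarrow> ('k \<Rightarrow>\<^sub>L 'k)) set"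
    assume "W \<in> {{L \<in> bounded_maps E. z L \<in> U} |z U. z \<in> weak_star_predual E \<and> open U}"
    then obtain z U where W: "W = {L \<in> bounded_maps E. z L \<in> U}" "z \<in> weak_star_predual E" "open U"
      by blast
    have "openin (top_of_set X) (X \<inter> (\<lambda>p. z (\<Gamma> p)) -` U)"
      unfolding X_def \<Gamma>_def
      by (intro continuous_openin_preimage_gen predual_functional_continuous_on_coefficients H E W)
    moreover have "\<Gamma> p \<in> bounded_maps E" if "p \<in> X" for p using img bdd that by blast
    then have "\<Gamma> -` W \<inter> topspace (top_of_set X) = X \<inter> (\<lambda>p. z (\<Gamma> p)) -` U"
      by (auto simp: W(1))
    ultimately show "openin (top_of_set X) (\<Gamma> -` W \<inter> topspace (top_of_set X))" by simp
  next
    \<comment> \<open>the topology lives on the union of its subbasis, so the predual must be shown to be nonempty\<close>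
    have "idop H \<in> E" using E by (simp add: operator_system_def)
    from matrix_coefficient_in_predual[OF this, of "0 :: 'k" 0]
    obtain z :: "(_ \<Rightarrow> ('k \<Rightarrow>\<^sub>L 'k)) \<Rightarrow> complex" where z: "z \<in> weak_star_predual E" by blast
    have "\<Gamma> ` topspace (top_of_set X) \<subseteq> {L \<in> bounded_maps E. z L \<in> UNIV}"
      using img bdd by simp
    also have "\<dots> \<subseteq> \<Union> {{L \<in> bounded_maps E. z L \<in> U} |z U. z \<in> weak_star_predual E \<and> open U}"
      using z by (intro Union_upper) blast
    finally show "\<Gamma> ` topspace (top_of_set X) \<subseteq>
      \<Union> {{L \<in> bounded_maps E. z L \<in> U} |z U. z \<in> weak_star_predual E \<and> open U}" .
  qed
  moreover have "compact X"
    unfolding X_def by (rule compact_coefficients_UCP[OF H E])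
  then have "compactin (top_of_set X) X" by (simp add: compactin_subtopology)
  ultimately have "compactin (weak_star_topology E) (\<Gamma> ` X)"
    by (intro image_compactin)
  then show ?thesis by (simp only: img)
qed

lemma compact_space_BW_topology:
  assumes "hilbert_subspace H" "operator_system H E"
  shows "compact_space (BW_topology H E)"
  unfolding BW_topology_def
  using compactin_weak_star_UCP[OF assms] by (rule compact_space_subtopology)

lemma BW_topology_separates:
  assumes E: "operator_system H E" and phi: "\<phi> \<in> UCP H E" "\<psi> \<in> UCP H E" "\<phi> \<noteq> \<psi>"
    and H: "hilbert_subspace H"
  obtains V where "openin (BW_topology H E) V" "\<phi> \<in> V" "\<psi> \<notin> V"
proof -
  obtain x where x: "x \<in> E" "\<phi> x \<noteq> \<psi> x"
    using extensionalityI[OF UCP_extensional[OF phi(1)] UCP_extensional[OF phi(2)]] phi(3) by blast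
  then obtain h h' where h: "cinner (blinfun_apply (\<phi> x) h) h' \<noteq> cinner (blinfun_apply (\<psi> x) h) h'"
    by (metis blinfun_eqI cinner_ext)
  define z where "z = (\<lambda>L. cinner (blinfun_apply (L x) h) h')"
  define U where "U = {L \<in> bounded_maps E. z L \<in> - {z \<psi>}}"
  have z: "z \<in> weak_star_predual E" unfolding z_def by (rule matrix_coefficient_in_predual[OF x(1)])
  have "openin (weak_star_topology E) U"
    unfolding weak_star_topology_def U_def using z
    by (intro topology_generated_by_Basis CollectI exI[of _ z] exI[of _ "- {z \<psi>}"]) auto
  then have "openin (BW_topology H E) (U \<inter> UCP H E)"
    unfolding BW_topology_def openin_subtopology by blast
  moreover have "\<phi> \<in> U \<inter> UCP H E"
    using phi(1) UCP_subset_bounded_maps[OF H E] h by (auto simp: U_def z_def)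
  moreover have "\<psi> \<notin> U \<inter> UCP H E" by (simp add: U_def)
  ultimately show ?thesis by (rule that)
qed

section \<open>The metric on ucp maps\<close>

text \<open>
  For a finite distance function the balls of the extended and of the real-valued metric agree, and so
  do the topologies they define.
\<close>

lemma compact_metricI_emetric_topology:
  assumes finite: "\<And>x y. x \<in> M \<Longrightarrow> y \<in> M \<Longrightarrow> d x y < \<infinity>"
    and zero: "\<And>x y. x \<in> M \<Longrightarrow> y \<in> M \<Longrightarrow> d x y = 0 \<longleftrightarrow> x = y"
    and commute: "\<And>x y. x \<in> M \<Longrightarrow> y \<in> M \<Longrightarrow> d x y = d y x"
    and triangle: "\<And>x y z. x \<in> M \<Longrightarrow> y \<in> M \<Longrightarrow> z \<in> M \<Longrightarrow> d x z \<le> d x y + d y z"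
    and compact: "compact_space (emetric_topology M d)"
  shows "compact_metric M d"
proof -
  define e where "e = (\<lambda>x y. if x \<in> M \<and> y \<in> M then enn2real (d x y) else 0)"
  have d: "d x y = ennreal (e x y)" if "x \<in> M" "y \<in> M" for x y
    using finite[OF that] that by (simp add: e_def)
  have e_nonneg: "0 \<le> e x y" for x y by (simp add: e_def)
  have "Metric_space M e"
  proof
    show "0 \<le> e x y" for x y by (rule e_nonneg)
    show "e x y = e y x" for x y using commute by (simp add: e_def)
    show "e x y = 0 \<longleftrightarrow> x = y" if "x \<in> M" "y \<in> M" for x y
      using zero[OF that] that by (simp add: d e_nonneg)
    show "e x z \<le> e x y + e y z" if "x \<in> M" "y \<in> M" "z \<in> M" for x y z
      using triangle[OF that] that by (simp add: d e_nonneg flip: ennreal_plus)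
  qed
  then interpret M: Metric_space M e .
  have "M.mtopology = emetric_topology M d"
  proof (rule topology_eq[THEN iffD2], intro allI)
    fix U
    have "M.mball x r = {y \<in> M. d x y < ennreal r}" if "x \<in> M" for x r
      using that by (auto simp: M.mball_def d ennreal_less_iff e_nonneg)
    then show "openin M.mtopology U \<longleftrightarrow> openin (emetric_topology M d) U"
      unfolding M.openin_mtopology openin_emetric_topology by (metis subsetD)
  qed
  then show ?thesis
    unfolding compact_metric_def using compact M.Metric_space_axioms d by auto
qed

lemma spectral_tripleD:
  assumes "spectral_triple A"
  shows "hilbert_subspace (hspace A)" "operator_system (hspace A) (opsys A)"
    "csubspace (smooth A)" "csubspace (opsys A)" "idop (hspace A) \<in> opsys A"
  using assms by (auto simp: spectral_triple_def operator_system_def)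

lemma smooth_subset_opsys: "f \<in> smooth A \<Longrightarrow> f \<in> opsys A"
  using closure_subset by (auto simp: opsys_def)

text \<open>
  A supremum of real numbers is at least one of its members only if it is bounded above, which is
  what the boundedness of the commutator provides.
\<close>

lemma lipnorm_nonneg:
  assumes A: "spectral_triple A" and f: "f \<in> smooth A"
  shows "0 \<le> lipnorm A f"
proof -
  let ?c = "\<lambda>x. norm (dirac A (blinfun_apply f x) - blinfun_apply f (dirac A x))"
  obtain C where C: "\<And>x. x \<in> ddom A \<Longrightarrow> ?c x \<le> C * norm x"
    using A f unfolding spectral_triple_def bounded_commutator_def by blast
  have "csubspace (ddom A)"
    using A by (simp add: spectral_triple_def self_adjoint_in_def)
  then have "0 \<in> ddom A" using csubspaceD(1) subspace_0 by blast
  have "?c x \<le> \<bar>C\<bar>" if "x \<in> ddom A" "norm x \<le> 1" for x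
  proof -
    have "?c x \<le> C * norm x" by (rule C[OF that(1)])
    also have "\<dots> \<le> \<bar>C\<bar> * 1" using that(2) by (intro mult_mono) simp_all
    finally show ?thesis by simp
  qed
  then have "bdd_above (?c ` {x \<in> ddom A. norm x \<le> 1})"
    by (intro bdd_aboveI[of _ "\<bar>C\<bar>"]) auto
  then have "?c 0 \<le> lipnorm A f"
    unfolding lipnorm_def using \<open>0 \<in> ddom A\<close> by (intro cSUP_upper) simp_all
  then show ?thesis using norm_ge_zero order_trans by blast
qed

text \<open>
  The vectors \<open>k\<^sub>p\<close> lie in the unit ball and the weights \<open>1/2\<^sup>p\<^sup>+\<^sup>1\<close> sum to \<open>1\<close>, so an operator norm bound
  on the Lipschitz unit ball passes to the distance.
\<close>

lemma ucp_dist_le: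
  assumes k: "range k \<subseteq> cball 0 1" and C: "C \<ge> 0"
    and le: "\<And>f. f \<in> smooth A \<Longrightarrow> norm f \<le> 1 \<Longrightarrow> lipnorm A f \<le> 1 \<Longrightarrow> norm (\<phi> f - \<psi> f) \<le> C"
  shows "ucp_dist k A \<phi> \<psi> \<le> ennreal C"
  unfolding ucp_dist_def
proof (rule SUP_least)
  fix f assume "f \<in> {f \<in> smooth A. norm f \<le> 1 \<and> lipnorm A f \<le> 1}"
  then have f: "norm (\<phi> f - \<psi> f) \<le> C" using le by blast
  have k1: "norm (k p) \<le> 1" for p using subsetD[OF k rangeI[of k p]] by simp
  have "cmod (cinner (blinfun_apply (\<phi> f - \<psi> f) (k p)) (k p)) \<le> C" for p
  proof -
    have "cmod (cinner (blinfun_apply (\<phi> f - \<psi> f) (k p)) (k p))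
      \<le> norm (blinfun_apply (\<phi> f - \<psi> f) (k p)) * norm (k p)" by (rule norm_cinner_le)
    also have "\<dots> \<le> norm (\<phi> f - \<psi> f) * norm (k p) * norm (k p)"
      by (intro mult_right_mono norm_blinfun) simp
    also have "\<dots> \<le> C * 1 * 1"
      using f k1 C by (intro mult_mono) simp_all
    finally show ?thesis by simp
  qed
  then have "(\<Sum>p. ennreal (1 / 2 ^ Suc p * cmod (cinner (blinfun_apply (\<phi> f - \<psi> f) (k p)) (k p))))
    \<le> (\<Sum>p. ennreal ((1 / 2) ^ Suc p * C))"
    by (intro suminf_le ennreal_leI summableI)
      (simp_all only: power_one_over mult_left_mono zero_le_divide_1_iff zero_le_power zero_le_numeral)
  also have "\<dots> = ennreal C"
    using sums_mult2[OF power_half_series, of C] C by (intro suminf_ennreal_eq) simp_all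
  finally show "(\<Sum>p. ennreal (1 / 2 ^ Suc p * cmod (cinner (blinfun_apply (\<phi> f - \<psi> f) (k p)) (k p))))
    \<le> ennreal C" .
qed

lemma ucp_dist_commute: "ucp_dist k A \<phi> \<psi> = ucp_dist k A \<psi> \<phi>"
proof -
  have "cmod (cinner (blinfun_apply (\<phi> f - \<psi> f) h) h) = cmod (cinner (blinfun_apply (\<psi> f - \<phi> f) h) h)" for f h
    by (simp add: blinfun.diff_left cinner_diff_left norm_minus_commute)
  then show ?thesis by (simp add: ucp_dist_def)
qed

lemma ucp_dist_triangle:
  fixes \<phi> \<psi> \<theta> :: "('h::chilbert_space \<Rightarrow>\<^sub>L 'h) \<Rightarrow> ('k::chilbert_space \<Rightarrow>\<^sub>L 'k)"
  shows "ucp_dist k A \<phi> \<theta> \<le> ucp_dist k A \<phi> \<psi> + ucp_dist k A \<psi> \<theta>"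
proof -
  define D where "D = (\<lambda>(\<phi> :: ('h \<Rightarrow>\<^sub>L 'h) \<Rightarrow> ('k \<Rightarrow>\<^sub>L 'k)) \<psi> f p. ennreal (1 / 2 ^ Suc p *
    cmod (cinner (blinfun_apply (\<phi> f - \<psi> f) (k p)) (k p))))"
  have eq: "ucp_dist k A \<phi> \<psi> = (SUP f\<in>{f \<in> smooth A. norm f \<le> 1 \<and> lipnorm A f \<le> 1}. \<Sum>p. D \<phi> \<psi> f p)" for \<phi> \<psi>
    by (simp only: ucp_dist_def D_def)
  have "D \<phi> \<theta> f p \<le> D \<phi> \<psi> f p + D \<psi> \<theta> f p" for f p
  proof -
    let ?c = "\<lambda>\<phi>. cinner (blinfun_apply (\<phi> f) (k p)) (k p)"
    have "cmod (?c \<phi> - ?c \<theta>) \<le> cmod (?c \<phi> - ?c \<psi>) + cmod (?c \<psi> - ?c \<theta>)"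
      using norm_triangle_ineq[of "?c \<phi> - ?c \<psi>" "?c \<psi> - ?c \<theta>"] by simp
    then have "1 / 2 ^ Suc p * cmod (?c \<phi> - ?c \<theta>) \<le>
      1 / 2 ^ Suc p * cmod (?c \<phi> - ?c \<psi>) + 1 / 2 ^ Suc p * cmod (?c \<psi> - ?c \<theta>)"
      unfolding distrib_left[symmetric] by (rule mult_left_mono) simp
    then show ?thesis
      unfolding D_def by (subst ennreal_plus[symmetric])
        (simp_all only: blinfun.diff_left cinner_diff_left ennreal_leI, simp_all)
  qed
  then have "(\<Sum>p. D \<phi> \<theta> f p) \<le> (\<Sum>p. D \<phi> \<psi> f p) + (\<Sum>p. D \<psi> \<theta> f p)" for f
    unfolding suminf_add[OF summableI summableI] by (intro suminf_le summableI)
  then show ?thesis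
    unfolding eq by (intro SUP_least) (meson SUP_upper add_mono order_trans)
qed

text \<open>
  Compactness and the separation of points are inherited from the BW-topology: two maps at distance
  \<open>0\<close> lie in the same open sets of the metric topology, hence in the same BW-open sets.
\<close>

lemma compact_metric_UCP_of:
  fixes k :: "nat \<Rightarrow> 'k::chilbert_space"
  assumes A: "spectral_triple A" and BW: "BW_property k A" and k: "range k \<subseteq> cball 0 1"
  shows "compact_metric (UCP_of A) (ucp_dist k A)"
proof (rule compact_metricI_emetric_topology)
  note sp = spectral_tripleD[OF A]
  have top: "emetric_topology (UCP_of A) (ucp_dist k A) = BW_topology (hspace A) (opsys A)"
    using BW by (simp add: BW_property_def)
  show "compact_space (emetric_topology (UCP_of A) (ucp_dist k A))"
    unfolding top by (rule compact_space_BW_topology[OF sp(1,2)])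
  show "ucp_dist k A \<phi> \<psi> = ucp_dist k A \<psi> \<phi>" for \<phi> \<psi> by (rule ucp_dist_commute)
  show "ucp_dist k A \<phi> \<theta> \<le> ucp_dist k A \<phi> \<psi> + ucp_dist k A \<psi> \<theta>" for \<phi> \<psi> \<theta>
    by (rule ucp_dist_triangle)
  fix \<phi> \<psi> :: "_ \<Rightarrow> ('k \<Rightarrow>\<^sub>L 'k)"
  assume "\<phi> \<in> UCP_of A" "\<psi> \<in> UCP_of A"
  then have phi: "\<phi> \<in> UCP (hspace A) (opsys A)" "\<psi> \<in> UCP (hspace A) (opsys A)"
    by (simp_all add: UCP_of_def)
  have "norm (\<phi> f - \<psi> f) \<le> 2" if "f \<in> smooth A" "norm f \<le> 1" for f
    using UCP_norm_le[OF sp(1,2) phi(1) smooth_subset_opsys[OF that(1)]]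
      UCP_norm_le[OF sp(1,2) phi(2) smooth_subset_opsys[OF that(1)]]
      norm_triangle_ineq4[of "\<phi> f" "\<psi> f"] that(2) by linarith
  then have "ucp_dist k A \<phi> \<psi> \<le> ennreal 2" by (intro ucp_dist_le[OF k]) simp_all
  then show "ucp_dist k A \<phi> \<psi> < \<infinity>" 
    unfolding infinity_ennreal_def by (rule le_less_trans[OF _ ennreal_less_top])
  show "ucp_dist k A \<phi> \<psi> = 0 \<longleftrightarrow> \<phi> = \<psi>"
  proof
    assume zero: "ucp_dist k A \<phi> \<psi> = 0"
    show "\<phi> = \<psi>"
    proof (rule ccontr)
      assume "\<phi> \<noteq> \<psi>"
      then obtain V where V: "openin (BW_topology (hspace A) (opsys A)) V" "\<phi> \<in> V" "\<psi> \<notin> V"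
        using BW_topology_separates[OF sp(2) phi _ sp(1)] by blast
      then obtain r where "r > 0" "{\<theta> \<in> UCP_of A. ucp_dist k A \<phi> \<theta> < ennreal r} \<subseteq> V"
        unfolding top[symmetric] openin_emetric_topology by blast
      then show False using zero phi(2) V(3) by (auto simp: UCP_of_def)
    qed
  next
    assume "\<phi> = \<psi>"
    then have "ucp_dist k A \<phi> \<psi> \<le> ennreal 0" by (intro ucp_dist_le[OF k]) simp_all
    then show "ucp_dist k A \<phi> \<psi> = 0" by simp
  qed
qed

section \<open>Gromov-Hausdorff distance and almost inverse short maps\<close>

text \<open>
  The union of the two spaces is metrized by \<open>max (d1 x (G y)) (d2 (F x) y) + r\<close> across the two parts.
  The triangle inequalities that bound a distance across the parts follow from the 1-Lipschitz
  conditions, those between points of one part through a point of the other from one component of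
  the maximum.  The constant \<open>r > 0\<close> is there only to keep the two parts disjoint, and it tends to \<open>0\<close> at
  the end.  In this metric \<open>x\<close> and \<open>F x\<close> have distance at most \<open>\<epsilon> + r\<close>, and so do \<open>G y\<close> and \<open>y\<close>.
\<close>

lemma gromov_hausdorff_dist_le_short_maps:
  fixes M1 :: "'a set" and M2 :: "'b set"
  assumes c1: "compact_metric M1 d1" and c2: "compact_metric M2 d2"
    and F: "\<And>x. x \<in> M1 \<Longrightarrow> F x \<in> M2" and G: "\<And>y. y \<in> M2 \<Longrightarrow> G y \<in> M1"
    and shortF: "\<And>x x'. x \<in> M1 \<Longrightarrow> x' \<in> M1 \<Longrightarrow> d2 (F x) (F x') \<le> d1 x x'"
    and shortG: "\<And>y y'. y \<in> M2 \<Longrightarrow> y' \<in> M2 \<Longrightarrow> d1 (G y) (G y') \<le> d2 y y'"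
    and GF: "\<And>x. x \<in> M1 \<Longrightarrow> d1 x (G (F x)) \<le> ennreal \<epsilon>"
    and FG: "\<And>y. y \<in> M2 \<Longrightarrow> d2 y (F (G y)) \<le> ennreal \<epsilon>"
  shows "gromov_hausdorff_dist M1 d1 M2 d2 \<le> ennreal \<epsilon>"
proof (rule ennreal_le_epsilon)
  fix r :: real assume r: "r > 0"
  obtain e1 where e1: "Metric_space M1 e1" "\<And>x x'. x \<in> M1 \<Longrightarrow> x' \<in> M1 \<Longrightarrow> d1 x x' = ennreal (e1 x x')"
    using c1 unfolding compact_metric_def by blast
  obtain e2 where e2: "Metric_space M2 e2" "\<And>y y'. y \<in> M2 \<Longrightarrow> y' \<in> M2 \<Longrightarrow> d2 y y' = ennreal (e2 y y')"
    using c2 unfolding compact_metric_def by blast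
  interpret M1: Metric_space M1 e1 by fact
  interpret M2: Metric_space M2 e2 by fact
  have sF: "e2 (F x) (F x') \<le> e1 x x'" if "x \<in> M1" "x' \<in> M1" for x x'
    using shortF[OF that] that F by (simp add: e1(2) e2(2) M1.nonneg)
  have sG: "e1 (G y) (G y') \<le> e2 y y'" if "y \<in> M2" "y' \<in> M2" for y y'
    using shortG[OF that] that G by (simp add: e1(2) e2(2) M2.nonneg)
  define c where "c = (\<lambda>x y. max (e1 x (G y)) (e2 (F x) y) + r)"
  define d :: "'a + 'b \<Rightarrow> 'a + 'b \<Rightarrow> real" where
    "d = (\<lambda>u v. case u of
        Inl x \<Rightarrow> (case v of Inl x' \<Rightarrow> e1 x x' | Inr y \<Rightarrow> c x y)
      | Inr y \<Rightarrow> (case v of Inl x \<Rightarrow> c x y | Inr y' \<Rightarrow> e2 y y'))"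
  have dI [simp]: "d (Inl x) (Inl x') = e1 x x'" "d (Inl x) (Inr y) = c x y"
    "d (Inr y) (Inl x) = c x y" "d (Inr y) (Inr y') = e2 y y'" for x x' y y'
    by (simp_all add: d_def)
  define M where "M = M1 <+> M2"
  have c_pos: "c x y > 0" for x y
    unfolding c_def using r M1.nonneg[of x "G y"] by linarith
  have c_tri1: "c x y \<le> e1 x x' + c x' y" if "x \<in> M1" "x' \<in> M1" "y \<in> M2" for x x' y
    using M1.triangle[OF that(1,2) G[OF that(3)]] M2.triangle[OF F[OF that(1)] F[OF that(2)] that(3)]
      sF[OF that(1,2)] by (simp add: c_def max_def)
  have c_tri2: "c x y \<le> c x y' + e2 y' y" if "x \<in> M1" "y \<in> M2" "y' \<in> M2" for x y y'
    using M1.triangle[OF that(1) G[OF that(3)] G[OF that(2)]] M2.triangle[OF F[OF that(1)] that(3,2)]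
      sG[OF that(3,2)] by (simp add: c_def max_def)
  have tri_c1: "e1 x x' \<le> c x y + c x' y" if "x \<in> M1" "x' \<in> M1" "y \<in> M2" for x x' y
    using M1.triangle[OF that(1) G[OF that(3)] that(2)] M1.commute[of x' "G y"] r
    by (simp add: c_def max_def)
  have tri_c2: "e2 y y' \<le> c x y + c x y'" if "x \<in> M1" "y \<in> M2" "y' \<in> M2" for x y y'
    using M2.triangle[OF that(2) F[OF that(1)] that(3)] M2.commute[of y "F x"] r
    by (simp add: c_def max_def)
  have M: "Metric_space M d"
  proof
    show "0 \<le> d u v" for u v
      using less_imp_le[OF c_pos] by (cases u; cases v) (simp_all add: M1.nonneg M2.nonneg)
    show "d u v = d v u" for u v
      by (cases u; cases v) (simp_all add: M1.commute M2.commute)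
    show "d u v = 0 \<longleftrightarrow> u = v" if "u \<in> M" "v \<in> M" for u v
      using that less_imp_neq[OF c_pos] by (cases u; cases v) (auto simp: M_def)
    show "d u w \<le> d u v + d v w" if uvw: "u \<in> M" "v \<in> M" "w \<in> M" for u v w
    proof (cases u; cases v; cases w)
      fix x x' x'' assume "u = Inl x" "v = Inl x'" "w = Inl x''"
      then show ?thesis using uvw M1.triangle by (auto simp: M_def)
    next
      fix x x' y assume "u = Inl x" "v = Inl x'" "w = Inr y"
      then show ?thesis using uvw c_tri1 by (auto simp: M_def)
    next
      fix x x' y assume "u = Inl x" "v = Inr y" "w = Inl x'"
      then show ?thesis using uvw tri_c1 by (auto simp: M_def)
    next
      fix x y y' assume "u = Inl x" "v = Inr y'" "w = Inr y"
      then show ?thesis using uvw c_tri2 by (auto simp: M_def)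
    next
      fix x x' y assume "u = Inr y" "v = Inl x'" "w = Inl x"
      then show ?thesis using uvw c_tri1[of x x' y] by (auto simp: M_def M1.commute)
    next
      fix x y y' assume "u = Inr y" "v = Inl x" "w = Inr y'"
      then show ?thesis using uvw tri_c2 by (auto simp: M_def)
    next
      fix x y y' assume "u = Inr y" "v = Inr y'" "w = Inl x"
      then show ?thesis using uvw c_tri2[of x y y'] by (auto simp: M_def M2.commute)
    next
      fix y y' y'' assume "u = Inr y" "v = Inr y'" "w = Inr y''"
      then show ?thesis using uvw M2.triangle by (auto simp: M_def)
    qed
  qed
  interpret M: Metric_space M d by fact
  have emb1: "isometric_embedding M1 d1 M d Inl" and emb2: "isometric_embedding M2 d2 M d Inr"
    by (auto simp: isometric_embedding_def M_def e1(2) e2(2))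
  have "compactin M.mtopology (Inl ` M1 \<union> Inr ` M2)"
    using compactin_isometric_image[OF c1 M emb1] compactin_isometric_image[OF c2 M emb2]
    by (rule compactin_Un)
  then have "compact_space M.mtopology"
    unfolding compact_space_def M.topspace_mtopology by (simp add: M_def Plus_def)
  then have "gromov_hausdorff_dist M1 d1 M2 d2 \<le> hausdorff_dist d (Inl ` M1) (Inr ` M2)"
    unfolding gromov_hausdorff_dist_def using M emb1 emb2
    by (intro Inf_lower) blast
  also have "\<dots> \<le> ennreal \<epsilon> + ennreal r"
  proof -
    \<comment> \<open>for \<open>y = F x\<close> or \<open>x = G y\<close> one component of the maximum in \<open>c x y\<close> vanishes and the other
      is at most \<open>\<epsilon>\<close>; the truncation at \<open>0\<close> records the vanishing one\<close>
    have le: "ennreal (max a 0 + r) \<le> ennreal \<epsilon> + ennreal r" if "ennreal a \<le> ennreal \<epsilon>" for a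
    proof -
      have "ennreal (max a 0 + r) = ennreal (max a 0) + ennreal r"
        using r by (simp add: ennreal_plus)
      also have "ennreal (max a 0) = ennreal a" by (simp add: max_def ennreal_neg)
      finally show ?thesis using that by (simp add: add_right_mono)
    qed
    have "(INF v\<in>Inr ` M2. ennreal (d (Inl x) v)) \<le> ennreal \<epsilon> + ennreal r" if "x \<in> M1" for x
    proof (rule INF_lower2)
      show "Inr (F x) \<in> Inr ` M2" using F[OF that] by simp
      have "c x (F x) = max (e1 x (G (F x))) 0 + r" using F[OF that] by (simp add: c_def)
      then show "ennreal (d (Inl x) (Inr (F x))) \<le> ennreal \<epsilon> + ennreal r"
        using le[of "e1 x (G (F x))"] GF[OF that] that F G by (simp add: e1(2))
    qed
    moreover have "(INF u\<in>Inl ` M1. ennreal (d u (Inr y))) \<le> ennreal \<epsilon> + ennreal r" if "y \<in> M2" for y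
    proof (rule INF_lower2)
      show "Inl (G y) \<in> Inl ` M1" using G[OF that] by simp
      have "c (G y) y = max (e2 y (F (G y))) 0 + r"
        using G[OF that] by (simp add: c_def M2.commute max.commute)
      then show "ennreal (d (Inl (G y)) (Inr y)) \<le> ennreal \<epsilon> + ennreal r"
        using le[of "e2 y (F (G y))"] FG[OF that] that F G by (simp add: e2(2))
    qed
    ultimately show ?thesis
      by (auto simp: hausdorff_dist_def intro!: SUP_least)
  qed
  finally show "gromov_hausdorff_dist M1 d1 M2 d2 \<le> ennreal \<epsilon> + ennreal r" .
qed

section \<open>Convergence of the spaces of ucp maps\<close>

lemma UCP_of_pullback:
  assumes A: "spectral_triple A"
    and Q: "ucp_map (hspace A) (opsys A) (hspace B) (opsys B) Q" and psi: "\<psi> \<in> UCP_of B"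
  shows "restrict (\<psi> \<circ> Q) (opsys A) \<in> UCP_of A"
proof -
  note sp = spectral_tripleD[OF A]
  have cs: "x + y \<in> opsys A" "c *\<^sub>C x \<in> opsys A" if "x \<in> opsys A" "y \<in> opsys A" for x y c
    using csubspaceD[OF sp(4)] that by (simp_all add: subspace_add)
  have linQ: "clinear_on (opsys A) (opsys B) Q" and Q1: "Q (idop (hspace A)) = idop (hspace B)"
    and Qcp: "completely_positive (hspace A) (opsys A) (hspace B) Q"
    using Q by (auto simp: ucp_map_def)
  have psi': "\<psi> \<in> UCP (hspace B) (opsys B)" using psi by (simp add: UCP_of_def)
  have psi1: "\<psi> (idop (hspace B)) = idop UNIV"
    and psicp: "completely_positive (hspace B) (opsys B) UNIV \<psi>"
    using UCP_ucp_map[OF psi'] by (auto simp: ucp_map_def)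
  note linQ = clinear_onD[OF linQ] and linpsi = clinear_onD[OF UCP_clinear_on[OF psi']]
  have "clinear_on (opsys A) (bop UNIV) (restrict (\<psi> \<circ> Q) (opsys A))"
    unfolding clinear_on_def by (auto simp: cs linQ linpsi)
  moreover have "completely_positive (hspace A) (opsys A) UNIV (restrict (\<psi> \<circ> Q) (opsys A))"
    unfolding completely_positive_def
  proof (intro allI impI)
    fix m T assume T: "\<forall>i<m. \<forall>j<m. T i j \<in> opsys A" "mat_pos (hspace A) m T"
    then have "mat_pos (hspace B) m (\<lambda>i j. Q (T i j))"
      using Qcp unfolding completely_positive_def by blast
    then have "mat_pos UNIV m (\<lambda>i j. \<psi> (Q (T i j)))"
      using psicp T(1) linQ(1) unfolding completely_positive_def by simp
    then show "mat_pos UNIV m (\<lambda>i j. restrict (\<psi> \<circ> Q) (opsys A) (T i j))"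
      using T(1) by (simp add: mat_pos_def)
  qed
  ultimately show ?thesis
    using sp(5) by (simp add: UCP_of_def UCP_def ucp_map_def Q1 psi1)
qed

text \<open>
  The distance on the left is a supremum over the images \<open>R f\<close> of the Lipschitz unit ball of \<open>A\<close>, which
  form a part of the Lipschitz unit ball of \<open>B\<close>.
\<close>

lemma ucp_dist_pullback_le:
  fixes \<phi> \<psi> :: "('g::chilbert_space \<Rightarrow>\<^sub>L 'g) \<Rightarrow> ('k::chilbert_space \<Rightarrow>\<^sub>L 'k)"
  assumes R: "\<And>f. f \<in> smooth A \<Longrightarrow> R f \<in> smooth B" "contractive A B R"
    and Q: "\<And>f. f \<in> smooth A \<Longrightarrow> Q f = R f"
  shows "ucp_dist k A (restrict (\<phi> \<circ> Q) (opsys A)) (restrict (\<psi> \<circ> Q) (opsys A)) \<le> ucp_dist k B \<phi> \<psi>"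
proof -
  let ?ball = "\<lambda>A. {f \<in> smooth A. norm f \<le> 1 \<and> lipnorm A f \<le> 1}"
  define D where "D = (\<lambda>g. \<Sum>p. ennreal (1 / 2 ^ Suc p * cmod (cinner (blinfun_apply (\<phi> g - \<psi> g) (k p)) (k p))))"
  have "R f \<in> ?ball B" if "f \<in> ?ball A" for f
  proof -
    have "norm (R f) \<le> norm f" "lipnorm B (R f) \<le> lipnorm A f"
      using that R(2) by (simp_all add: contractive_def)
    with that R(1) show ?thesis by simp
  qed
  then have "D (R f) \<le> (SUP g\<in>?ball B. D g)" if "f \<in> ?ball A" for f
    using that by (intro SUP_upper)
  then have "(SUP f\<in>?ball A. D (R f)) \<le> (SUP g\<in>?ball B. D g)"
    by (rule SUP_least)
  moreover have "(SUP f\<in>?ball A. D (R f)) =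
      ucp_dist k A (restrict (\<phi> \<circ> Q) (opsys A)) (restrict (\<psi> \<circ> Q) (opsys A))"
    unfolding ucp_dist_def D_def by (intro SUP_cong refl) (simp add: Q smooth_subset_opsys)
  moreover have "(SUP g\<in>?ball B. D g) = ucp_dist k B \<phi> \<psi>"
    by (simp only: ucp_dist_def D_def)
  ultimately show ?thesis by simp
qed

text \<open>
  On the Lipschitz unit ball the round trip replaces \<open>\<phi>(f)\<close> by \<open>\<phi>(S (R f))\<close>, and the contractive map \<open>\<phi>\<close>
  sees a difference of norm at most \<open>\<bar>c\<bar>\<close>.  The sign of \<open>c\<close> is arbitrary, hence the absolute value.
\<close>

lemma ucp_dist_round_trip_le:
  assumes A: "spectral_triple A" and k: "range k \<subseteq> cball 0 1"
    and R: "\<And>f. f \<in> smooth A \<Longrightarrow> R f \<in> smooth B" and Q: "\<And>f. f \<in> smooth A \<Longrightarrow> Q f = R f"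
    and S: "\<And>h. h \<in> smooth B \<Longrightarrow> S h \<in> smooth A" and P: "\<And>h. h \<in> smooth B \<Longrightarrow> P h = S h"
    and approx: "\<And>f. f \<in> smooth A \<Longrightarrow> norm (S (R f) - f) \<le> c * lipnorm A f"
    and phi: "\<phi> \<in> UCP_of A"
  shows "ucp_dist k A \<phi> (restrict (restrict (\<phi> \<circ> P) (opsys B) \<circ> Q) (opsys A)) \<le> ennreal \<bar>c\<bar>"
proof (rule ucp_dist_le[OF k])
  note sp = spectral_tripleD[OF A]
  have phi': "\<phi> \<in> UCP (hspace A) (opsys A)" using phi by (simp add: UCP_of_def)
  fix f assume f: "f \<in> smooth A" "lipnorm A f \<le> 1"
  have SR: "S (R f) \<in> smooth A" using f R S by blast
  then have "f - S (R f) \<in> smooth A"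
    using f csubspaceD(1)[OF sp(3)] by (simp add: subspace_diff)
  then have mem: "f \<in> opsys A" "S (R f) \<in> opsys A" "f - S (R f) \<in> opsys A"
    using f SR smooth_subset_opsys by blast+
  have "norm (\<phi> f - restrict (restrict (\<phi> \<circ> P) (opsys B) \<circ> Q) (opsys A) f) = norm (\<phi> f - \<phi> (S (R f)))"
    using f R mem(1) by (simp add: Q P smooth_subset_opsys)
  also have "\<dots> = norm (\<phi> (f - S (R f)))"
    using clinear_on_diff[OF UCP_clinear_on[OF phi'] sp(4) mem(1,2)] by simp
  also have "\<dots> \<le> norm (f - S (R f))" by (rule UCP_norm_le[OF sp(1,2) phi' mem(3)])
  also have "\<dots> \<le> c * lipnorm A f" using approx[OF f(1)] by (simp add: norm_minus_commute)
  also have "\<dots> \<le> \<bar>c\<bar> * 1"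
    using f lipnorm_nonneg[OF A f(1)] by (intro mult_mono) simp_all
  finally show "norm (\<phi> f - restrict (restrict (\<phi> \<circ> P) (opsys B) \<circ> Q) (opsys A) f) \<le> \<bar>c\<bar>" by simp
qed simp

theorem theorem1:
  fixes k :: "nat \<Rightarrow> 'k::chilbert_space"
    and A :: "'h::chilbert_space striple"
    and An :: "nat \<Rightarrow> 'g::chilbert_space striple"
    and R :: "nat \<Rightarrow> ('h \<Rightarrow>\<^sub>L 'h) \<Rightarrow> ('g \<Rightarrow>\<^sub>L 'g)"
    and S :: "nat \<Rightarrow> ('g \<Rightarrow>\<^sub>L 'g) \<Rightarrow> ('h \<Rightarrow>\<^sub>L 'h)"
  assumes "separable_space (euclidean :: 'k topology)"
    and "range k \<subseteq> cball 0 1" and "cball 0 1 \<subseteq> closure (range k)"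
    and "spectral_triple A" and "\<And>n. spectral_triple (An n)"
    and "BW_property k A" and "\<And>n. BW_property k (An n)"
    and "C1_approx_coi An A R S"
  shows "compact_metric (UCP_of A) (ucp_dist k A) \<and>
         (\<forall>n. compact_metric (UCP_of (An n)) (ucp_dist k (An n))) \<and>
         (\<lambda>n. gromov_hausdorff_dist (UCP_of (An n)) (ucp_dist k (An n)) (UCP_of A) (ucp_dist k A))
           \<longlonglongrightarrow> 0"
proof (intro conjI allI)
  note k = assms(2) and A = assms(4) and An = assms(5)
  have lin: "clinear_on (smooth A) (smooth (An n)) (R n)" "clinear_on (smooth (An n)) (smooth A) (S n)"
    and ext: "ucp_extendable A (An n) (R n)" "ucp_extendable (An n) A (S n)"
    and contr: "contractive A (An n) (R n)" "contractive (An n) A (S n)" for n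
    using assms(8) by (simp_all add: C1_approx_coi_def)
  show cA: "compact_metric (UCP_of A) (ucp_dist k A)"
    by (rule compact_metric_UCP_of[OF A assms(6) k])
  show cAn: "compact_metric (UCP_of (An n)) (ucp_dist k (An n))" for n
    by (rule compact_metric_UCP_of[OF An assms(7) k])
  have "\<exists>c c'. c \<longlonglongrightarrow> 0 \<and> c' \<longlonglongrightarrow> 0 \<and>
      (\<forall>n. \<forall>f\<in>smooth A. norm (S n (R n f) - f) \<le> c n * lipnorm A f) \<and>
      (\<forall>n. \<forall>h\<in>smooth (An n). norm (R n (S n h) - h) \<le> c' n * lipnorm (An n) h)"
    using assms(8) unfolding C1_approx_coi_def by (elim conjE)
  then obtain c c' where c: "c \<longlonglongrightarrow> 0" "c' \<longlonglongrightarrow> 0"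
    and SR: "\<And>n f. f \<in> smooth A \<Longrightarrow> norm (S n (R n f) - f) \<le> c n * lipnorm A f"
    and RS: "\<And>n h. h \<in> smooth (An n) \<Longrightarrow> norm (R n (S n h) - h) \<le> c' n * lipnorm (An n) h"
    by blast
  note Rmem = clinear_onD(1)[OF lin(1)] and Smem = clinear_onD(1)[OF lin(2)]
  define \<epsilon> where "\<epsilon> = (\<lambda>n. max \<bar>c n\<bar> \<bar>c' n\<bar>)"
  have bound: "gromov_hausdorff_dist (UCP_of (An n)) (ucp_dist k (An n)) (UCP_of A) (ucp_dist k A)
      \<le> ennreal (\<epsilon> n)" for n
  proof -
    obtain Q where Q: "\<And>f. f \<in> smooth A \<Longrightarrow> Q f = R n f"
      "ucp_map (hspace A) (opsys A) (hspace (An n)) (opsys (An n)) Q"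
      using ext(1)[of n] unfolding ucp_extendable_def by auto
    obtain P where P: "\<And>h. h \<in> smooth (An n) \<Longrightarrow> P h = S n h"
      "ucp_map (hspace (An n)) (opsys (An n)) (hspace A) (opsys A) P"
      using ext(2)[of n] unfolding ucp_extendable_def by auto
    have \<epsilon>: "ennreal \<bar>c n\<bar> \<le> ennreal (\<epsilon> n)" "ennreal \<bar>c' n\<bar> \<le> ennreal (\<epsilon> n)"
      by (simp_all add: \<epsilon>_def ennreal_leI)
    show ?thesis
    proof (rule gromov_hausdorff_dist_le_short_maps[OF cAn cA])
      show "restrict (\<psi> \<circ> Q) (opsys A) \<in> UCP_of A" if "\<psi> \<in> UCP_of (An n)" for \<psi> :: "_ \<Rightarrow> 'k \<Rightarrow>\<^sub>L 'k"
        by (rule UCP_of_pullback[OF A Q(2) that])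
      show "restrict (\<phi> \<circ> P) (opsys (An n)) \<in> UCP_of (An n)" if "\<phi> \<in> UCP_of A" for \<phi> :: "_ \<Rightarrow> 'k \<Rightarrow>\<^sub>L 'k"
        by (rule UCP_of_pullback[OF An P(2) that])
      show "ucp_dist k A (restrict (\<psi> \<circ> Q) (opsys A)) (restrict (\<psi>' \<circ> Q) (opsys A))
          \<le> ucp_dist k (An n) \<psi> \<psi>'" for \<psi> \<psi>'
        by (rule ucp_dist_pullback_le[OF Rmem contr(1) Q(1)])
      show "ucp_dist k (An n) (restrict (\<phi> \<circ> P) (opsys (An n))) (restrict (\<phi>' \<circ> P) (opsys (An n)))
          \<le> ucp_dist k A \<phi> \<phi>'" for \<phi> \<phi>'
        by (rule ucp_dist_pullback_le[OF Smem contr(2) P(1)])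
      show "ucp_dist k (An n) \<psi> (restrict (restrict (\<psi> \<circ> Q) (opsys A) \<circ> P) (opsys (An n)))
          \<le> ennreal (\<epsilon> n)" if "\<psi> \<in> UCP_of (An n)" for \<psi>
        using ucp_dist_round_trip_le[OF An k Smem P(1) Rmem Q(1) RS that] \<epsilon>(2) by (rule order_trans)
      show "ucp_dist k A \<phi> (restrict (restrict (\<phi> \<circ> P) (opsys (An n)) \<circ> Q) (opsys A))
          \<le> ennreal (\<epsilon> n)" if "\<phi> \<in> UCP_of A" for \<phi>
        using ucp_dist_round_trip_le[OF A k Rmem Q(1) Smem P(1) SR that] \<epsilon>(1) by (rule order_trans)
    qed
  qed
  have "(\<lambda>n. ennreal (\<epsilon> n)) \<longlonglongrightarrow> ennreal 0"
  proof (rule tendsto_ennrealI)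
    have "\<epsilon> \<longlonglongrightarrow> max \<bar>0\<bar> \<bar>0\<bar>" unfolding \<epsilon>_def by (intro tendsto_intros c)
    then show "\<epsilon> \<longlonglongrightarrow> 0" by simp
  qed
  then have lim: "(\<lambda>n. ennreal (\<epsilon> n)) \<longlonglongrightarrow> 0" by simp
  show "(\<lambda>n. gromov_hausdorff_dist (UCP_of (An n)) (ucp_dist k (An n))
      (UCP_of A) (ucp_dist k A)) \<longlonglongrightarrow> 0"
  proof (rule tendsto_sandwich[OF _ _ tendsto_const lim])
    show "\<forall>\<^sub>F n in sequentially. gromov_hausdorff_dist (UCP_of (An n)) (ucp_dist k (An n))
      (UCP_of A) (ucp_dist k A) \<le> ennreal (\<epsilon> n)"
      by (intro always_eventually allI bound)
  qed simp
qed

end
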